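(* Let $k\ge0$ be an integer and let $l\in\mathbb{N}$ ($l\geq 1$). There exists a constant $C\ge0$ depending only on $k$ and $l$ such that for all integers $n\ge k+2$, all $\mathbf{p}=(p_0,\dots,p_{n-1})\in[0,1]^n$, and $X\sim X(n,\mathbf{p})$, \[ \mathbb{E}[\beta_k(X)] \le n^{k+1}q_k\,\min\{1,\ C(n r_k)^{-l}\}. \] Here, if $r_k=0$, the right-hand side is interpreted as $n^{k+1}q_k$.
   Context: Multi-parameter random complex $X(n,\mathbf{p})$: start with a set $V$ of $n$ vertices and retain each vertex independently with probability $p_0$; then iteratively, for $i=1,2,\dots,n-1$, each $(i+1)$-element set ($i$-simplex) all of whose proper nonempty subsets have been added is added independently with probability $p_i$. $X(n,\mathbf{p})$ is the distribution of the resulting random simplicial complex (possibly empty). Parameters: $q_{-1}=1$, $q_k=\prod_{i=0}^k p_i^{\binom{k+1}{i+1}}$ for $0\le k\le n-1$, and $r_k=q_{k+1}/q_k=\prod_{i=0}^{k+1}p_i^{\binom{k+1}{i}}$ for $-1\le k\le n-2$ (with $0/0=0$, $\binom00=1$). $\beta_k(X)$ is the $k$-th reduced Betti number over $\mathbb{R}$ (homology of the augmented chain complex with $C_{-1}(X)=\mathbb{R}$); for the empty complex $\beta_k=0$ for all $k\ge0$. *)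

theory Defs
  imports
    "HOL-Probability.Probability"
    "HOL-Analysis.Finite_Function_Topology"
    "Jordan_Normal_Form.VS_Connect"
begin

section \<open>The multi-parameter random simplicial complex\<close>

text \<open>
  A complex on the vertex set \<open>{..<n}\<close> is represented by the set of its nonempty faces, so
  that the empty complex is \<open>{}\<close>. The candidates at step \<open>i\<close> are the
  \<open>(i+1)\<close>-element vertex sets all of whose proper nonempty subsets are already present; for
  \<open>i = 0\<close> these are all the singletons, so the retention of the vertices is step 0.
\<close>

definition candidates :: "nat \<Rightarrow> nat \<Rightarrow> nat set set \<Rightarrow> nat set set" where
  "candidates n i K =
     {\<sigma>. \<sigma> \<subseteq> {..<n} \<and> card \<sigma> = i + 1 \<and> (\<forall>\<tau>. \<tau> \<subset> \<sigma> \<and> \<tau> \<noteq> {} \<longrightarrow> \<tau> \<in> K)}"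

definition add_simplices :: "nat \<Rightarrow> (nat \<Rightarrow> real) \<Rightarrow> nat \<Rightarrow> nat set set \<Rightarrow> nat set set pmf" where
  "add_simplices n p i K =
     map_pmf (\<lambda>coin. K \<union> {\<sigma> \<in> candidates n i K. coin \<sigma>})
       (Pi_pmf (candidates n i K) False (\<lambda>_. bernoulli_pmf (p i)))"

text \<open>The partial complex obtained from the steps \<open>0, \<dots>, m - 1\<close>.\<close>

primrec random_skeleton :: "nat \<Rightarrow> (nat \<Rightarrow> real) \<Rightarrow> nat \<Rightarrow> nat set set pmf" where
  "random_skeleton n p 0 = return_pmf {}"
| "random_skeleton n p (Suc i) = bind_pmf (random_skeleton n p i) (add_simplices n p i)"

definition random_complex :: "nat \<Rightarrow> (nat \<Rightarrow> real) \<Rightarrow> nat set set pmf" where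
  "random_complex n p = random_skeleton n p n"

definition qq :: "(nat \<Rightarrow> real) \<Rightarrow> nat \<Rightarrow> real" where
  "qq p k = (\<Prod>i\<le>k. p i ^ ((k + 1) choose (i + 1)))"

text \<open>Division by zero yields \<open>0\<close>, in accordance with the convention \<open>0/0 = 0\<close>.\<close>

definition rr :: "(nat \<Rightarrow> real) \<Rightarrow> nat \<Rightarrow> real" where
  "rr p k = qq p (k + 1) / qq p k"

lemma rr_eq_prod: "rr p k = (\<Prod>i\<le>k + 1. p i ^ ((k + 1) choose i))"
proof (cases "qq p k = 0")
  case True
  then obtain i where "i \<le> k" "p i = 0"
    by (auto simp: qq_def)
  then have "(\<Prod>i\<le>k + 1. p i ^ ((k + 1) choose i)) = 0"
    by (intro prod_zero bexI[of _ i]) (auto simp: zero_power binomial_eq_0_iff)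
  then show ?thesis
    using True by (simp add: rr_def)
next
  case False
  have "qq p (k + 1) = (\<Prod>i\<le>k + 1. p i ^ ((k + 1) choose (i + 1)) * p i ^ ((k + 1) choose i))"
    unfolding qq_def by (intro prod.cong refl) (simp add: power_add[symmetric] add.commute)
  also have "\<dots> = qq p k * (\<Prod>i\<le>k + 1. p i ^ ((k + 1) choose i))"
    unfolding prod.distrib by (simp add: qq_def binomial_eq_0 del: binomial_Suc_Suc)
  finally show ?thesis
    using False by (simp add: rr_def)
qed


section \<open>Reduced real homology and Betti numbers\<close>

type_synonym chain = "nat set \<Rightarrow>\<^sub>0 real"

text \<open>
  Simplices are oriented by the order of the vertices: the boundary of
  \<open>{v\<^sub>0 < \<dots> < v\<^sub>k}\<close> is the sum of the \<open>(-1) ^ j\<close> times the face omitting \<open>v\<^sub>j\<close>. In particular a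
  vertex has boundary the empty simplex (this is the augmentation), and the empty simplex has
  boundary 0.
\<close>

definition simplex_boundary :: "nat set \<Rightarrow> chain" where
  "simplex_boundary \<sigma> =
     (\<Sum>v\<in>\<sigma>. Poly_Mapping.single (\<sigma> - {v}) ((-1) ^ card {w \<in> \<sigma>. w < v}))"

definition boundary :: "chain \<Rightarrow> chain" where
  "boundary c = (\<Sum>\<sigma>\<in>Poly_Mapping.keys c. Poly_Mapping.lookup c \<sigma> *\<^sub>R simplex_boundary \<sigma>)"

text \<open>The empty simplex is added to the faces, so the chains of degree \<open>-1\<close> form a line.\<close>

definition chains :: "nat set set \<Rightarrow> int \<Rightarrow> chain set" where
  "chains K d = {c. Poly_Mapping.keys c \<subseteq> {\<sigma> \<in> insert {} K. finite \<sigma> \<and> int (card \<sigma>) = d + 1}}"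

definition cycles :: "nat set set \<Rightarrow> int \<Rightarrow> chain set" where
  "cycles K d = {c \<in> chains K d. boundary c = 0}"

definition boundaries :: "nat set set \<Rightarrow> int \<Rightarrow> chain set" where
  "boundaries K d = boundary ` chains K (d + 1)"

text \<open>
  The quotient of the subspace \<open>Z\<close> by the subspace \<open>B\<close>, on the set of cosets. The operations
  are written so that they do not depend on representatives (adding \<open>B\<close> in the scalar multiple
  matters only for the scalar 0). The ring components of the record are not used.
\<close>

definition quotient_space :: "'v::real_vector set \<Rightarrow> 'v set \<Rightarrow> (real, 'v set) module" where
  "quotient_space Z B =
     \<lparr>carrier = (\<lambda>z. (+) z ` B) ` Z, mult = undefined, one = undefined,
      zero = B, add = (\<lambda>S T. {s + t |s t. s \<in> S \<and> t \<in> T}),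
      smult = (\<lambda>a S. {a *\<^sub>R s + b |s b. s \<in> S \<and> b \<in> B})\<rparr>"

definition homology :: "nat set set \<Rightarrow> int \<Rightarrow> (real, chain set) module" where
  "homology K d = quotient_space (cycles K d) (boundaries K d)"

definition betti :: "int \<Rightarrow> nat set set \<Rightarrow> nat" where
  "betti d K = vectorspace.dim class_ring (homology K d)"

subsection \<open>Well-definedness\<close>

text \<open>
  The constant \<open>vectorspace.dim\<close> is meaningful only for vector spaces. For a set of faces closed
  under nonempty subsets the boundary squares to zero and the homology is indeed a vector space.
\<close>

lemma lookup_scaleR: "Poly_Mapping.lookup (r *\<^sub>R x) i = r *\<^sub>R Poly_Mapping.lookup (x :: 'a \<Rightarrow>\<^sub>0 real) i"
proof -
  have "finite {i. r *\<^sub>R Poly_Mapping.lookup x i \<noteq> 0}"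
    by (rule finite_subset[OF _ finite_keys[of x]]) (auto simp: in_keys_iff)
  then show ?thesis by (simp add: scaleR_poly_mapping_def)
qed

lemma boundary_eq_sum:
  assumes "finite A" "Poly_Mapping.keys c \<subseteq> A"
  shows "boundary c = (\<Sum>\<sigma>\<in>A. Poly_Mapping.lookup c \<sigma> *\<^sub>R simplex_boundary \<sigma>)"
  unfolding boundary_def using assms
  by (intro sum.mono_neutral_left) (auto simp: in_keys_iff)

lemma linear_boundary: "linear boundary"
proof
  fix b c :: chain
  let ?A = "Poly_Mapping.keys b \<union> Poly_Mapping.keys c"
  have *: "finite ?A" "Poly_Mapping.keys (b + c) \<subseteq> ?A" using Poly_Mapping.keys_add[of b c] by auto
  show "boundary (b + c) = boundary b + boundary c"
    using * boundary_eq_sum[of ?A b] boundary_eq_sum[of ?A c] boundary_eq_sum[of ?A "b+c"]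
    by (simp add: lookup_add scaleR_add_left sum.distrib)
next
  fix r and c :: chain
  have "Poly_Mapping.keys (r *\<^sub>R c) \<subseteq> Poly_Mapping.keys c"
    by (auto simp: in_keys_iff lookup_scaleR)
  then show "boundary (r *\<^sub>R c) = r *\<^sub>R boundary c"
    using boundary_eq_sum[of "Poly_Mapping.keys c" "r *\<^sub>R c"] boundary_def[of c]
    by (simp add: lookup_scaleR scaleR_sum_right)
qed

lemma boundary_single: "boundary (Poly_Mapping.single \<sigma> a) = a *\<^sub>R simplex_boundary \<sigma>"
  by (cases "a = 0") (simp_all add: boundary_def)

lemma scaleR_single: "a *\<^sub>R Poly_Mapping.single \<sigma> (b::real) = Poly_Mapping.single \<sigma> (a * b)"
  by (rule poly_mapping_eqI) (simp add: lookup_scaleR lookup_single when_def)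

lemma boundary_simplex_boundary: "boundary (simplex_boundary \<sigma>) = 0"
proof (cases "finite \<sigma>")
  case True
  define s where "s \<tau> v = ((-1::real) ^ card {w \<in> \<tau>. w < v})" for \<tau> and v :: nat
  define t where "t v u = Poly_Mapping.single (\<sigma> - {v} - {u}) (s \<sigma> v * s (\<sigma> - {v}) u)" for v u
  define P where "P = (SIGMA v:\<sigma>. \<sigma> - {v})"
  have "boundary (simplex_boundary \<sigma>) = (\<Sum>v\<in>\<sigma>. \<Sum>u\<in>\<sigma> - {v}. t v u)"
    by (simp add: simplex_boundary_def[of \<sigma>] linear_sum[OF linear_boundary] boundary_single)
      (simp add: simplex_boundary_def scaleR_sum_right scaleR_single t_def s_def)
  also have "\<dots> = (\<Sum>(v,u)\<in>P. t v u)"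
    unfolding P_def using True by (simp add: sum.Sigma)
  finally have 1: "boundary (simplex_boundary \<sigma>) = (\<Sum>(v,u)\<in>P. t v u)" .
  have 2: "(\<Sum>(v,u)\<in>P. t v u) = (\<Sum>(v,u)\<in>P. t u v)"
    by (rule sum.reindex_bij_witness[of _ "\<lambda>(a,b). (b,a)" "\<lambda>(a,b). (b,a)"]) (auto simp: P_def)
  have anti: "s \<sigma> v * s (\<sigma> - {v}) u = - (s \<sigma> u * s (\<sigma> - {u}) v)" if "v \<in> \<sigma>" "u \<in> \<sigma>" "v < u" for u v
  proof -
    have "{w \<in> \<sigma>. w < u} = insert v {w \<in> \<sigma> - {v}. w < u}" using that by auto
    then have "s \<sigma> u = - s (\<sigma> - {v}) u"
      using True by (simp add: s_def)
    moreover have "{w \<in> \<sigma> - {u}. w < v} = {w \<in> \<sigma>. w < v}" using that by auto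
    then have "s (\<sigma> - {u}) v = s \<sigma> v" by (simp add: s_def)
    ultimately show ?thesis by simp
  qed
  have "t u v = - t v u" if "(v, u) \<in> P" for v u
  proof -
    have "\<sigma> - {v} - {u} = \<sigma> - {u} - {v}" by auto
    moreover have "s \<sigma> u * s (\<sigma> - {u}) v = - (s \<sigma> v * s (\<sigma> - {v}) u)"
      using that anti[of v u] anti[of u v] by (cases "v < u") (auto simp: P_def)
    ultimately show ?thesis unfolding t_def by (simp flip: single_uminus)
  qed
  then have "(\<Sum>(v,u)\<in>P. t u v) = - (\<Sum>(v,u)\<in>P. t v u)"
    unfolding sum_negf[symmetric] by (intro sum.cong) auto
  with 2 have "(\<Sum>(v,u)\<in>P. t v u) = - (\<Sum>(v,u)\<in>P. t v u)" by simp
  then have "(2::real) *\<^sub>R (\<Sum>(v,u)\<in>P. t v u) = 0" 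
    by (metis (no_types, lifting) add.right_inverse scaleR_2)
  with 1 show ?thesis by simp
qed (simp add: simplex_boundary_def boundary_def)

lemma boundary_boundary: "boundary (boundary c) = 0"
  by (simp add: boundary_def[of c] linear_sum[OF linear_boundary] linear_cmul[OF linear_boundary]
      boundary_simplex_boundary)

lemma coset_eq_iff:
  assumes "real_vector.subspace B"
  shows "(+) (x::'v::real_vector) ` B = (+) y ` B \<longleftrightarrow> x - y \<in> B"
proof
  assume "(+) x ` B = (+) y ` B"
  moreover have "x \<in> (+) x ` B" using real_vector.subspace_0[OF assms] by force
  ultimately obtain b where "b \<in> B" "x = y + b" by auto
  then show "x - y \<in> B" by simp
next
  assume xy: "x - y \<in> B"
  then have yx: "y - x \<in> B" using real_vector.subspace_neg[OF assms xy] by simp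
  have "x + b \<in> (+) y ` B" if "b \<in> B" for b
    using real_vector.subspace_add[OF assms xy that] by (intro image_eqI[of _ _ "x - y + b"]) auto
  moreover have "y + b \<in> (+) x ` B" if "b \<in> B" for b
    using real_vector.subspace_add[OF assms yx that] by (intro image_eqI[of _ _ "y - x + b"]) auto
  ultimately show "(+) x ` B = (+) y ` B" by auto
qed

lemma coset_add:
  assumes "real_vector.subspace B"
  shows "{s + t |s t. s \<in> (+) x ` B \<and> t \<in> (+) y ` B} = (+) (x + y) ` (B :: 'v::real_vector set)"
proof safe
  fix b c assume "b \<in> B" "c \<in> B"
  then show "x + b + (y + c) \<in> (+) (x + y) ` B"
    using real_vector.subspace_add[OF assms] by (intro image_eqI[of _ _ "b + c"]) (auto simp: algebra_simps)
next
  fix b assume "b \<in> B"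
  then show "\<exists>s t. x + y + b = s + t \<and> s \<in> (+) x ` B \<and> t \<in> (+) y ` B"
    using real_vector.subspace_0[OF assms] by (intro exI[of _ "x + b"] exI[of _ "y + 0"]) (auto simp: algebra_simps)
qed

lemma coset_scale:
  assumes "real_vector.subspace B"
  shows "{a *\<^sub>R s + b |s b. s \<in> (+) x ` B \<and> b \<in> B} = (+) (a *\<^sub>R x) ` (B :: 'v::real_vector set)"
proof safe
  fix b c assume "b \<in> B" "c \<in> B"
  then show "a *\<^sub>R (x + b) + c \<in> (+) (a *\<^sub>R x) ` B"
    using real_vector.subspace_add[OF assms] real_vector.subspace_scale[OF assms]
    by (intro image_eqI[of _ _ "a *\<^sub>R b + c"]) (auto simp: algebra_simps)
next
  fix b assume "b \<in> B"
  then show "\<exists>s b'. a *\<^sub>R x + b = a *\<^sub>R s + b' \<and> s \<in> (+) x ` B \<and> b' \<in> B"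
    using real_vector.subspace_0[OF assms] by (intro exI[of _ "x + 0"] exI[of _ b]) (auto simp: algebra_simps)
qed

lemma quotient_space_vectorspace:
  fixes Z B :: "'v::real_vector set"
  assumes Z: "real_vector.subspace Z" and B: "real_vector.subspace B" and "B \<subseteq> Z"
  shows "vectorspace class_ring (quotient_space Z B)"
proof -
  have zero: "B = (+) 0 ` B" by simp
  note simps = coset_add[OF B] coset_scale[OF B]
  have add: "add (quotient_space Z B) ((+) x ` B) ((+) y ` B) = (+) (x + y) ` B" for x y
    by (simp add: quotient_space_def coset_add[OF B])
  have smult: "smult (quotient_space Z B) a ((+) x ` B) = (+) (a *\<^sub>R x) ` B" for x a
    by (simp add: quotient_space_def coset_scale[OF B])
  have z: "zero (quotient_space Z B) = (+) 0 ` B"  by (simp add: quotient_space_def)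
  have c: "carrier (quotient_space Z B) = (\<lambda>z. (+) z ` B) ` Z" by (simp add: quotient_space_def)
  show ?thesis
  proof (rule vs_criteria)
    show "field (class_ring :: real ring)" by (rule class_field.field_axioms)
    show "\<zero>\<^bsub>quotient_space Z B\<^esub> \<in> carrier (quotient_space Z B)"
      unfolding z c using real_vector.subspace_0[OF Z] by blast
    show "\<forall>v\<in>carrier (quotient_space Z B). (\<exists>neg_v\<in>carrier (quotient_space Z B).
      v \<oplus>\<^bsub>quotient_space Z B\<^esub> neg_v = \<zero>\<^bsub>quotient_space Z B\<^esub>)"
      unfolding c
    proof safe
      fix x assume "x \<in> Z"
      then show "\<exists>neg_v\<in>(\<lambda>z. (+) z ` B) ` Z. (+) x ` B \<oplus>\<^bsub>quotient_space Z B\<^esub> neg_v = \<zero>\<^bsub>quotient_space Z B\<^esub>"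
        using real_vector.subspace_neg[OF Z \<open>x \<in> Z\<close>] by (intro bexI[of _ "(+) (-x) ` B"]) (auto simp only: add z add.right_inverse intro!: imageI)
    qed
  qed (unfold c ball_simps class_ring_simps,
      auto simp only: add smult z add.right_neutral scaleR_one scaleR_scaleR scaleR_add_left
        scaleR_add_right ac_simps UNIV_I
        intro!: imageI real_vector.subspace_add[OF Z] real_vector.subspace_scale[OF Z])
qed

lemma subspace_chains: "real_vector.subspace (chains K d)"
proof -
  have "Poly_Mapping.keys (r *\<^sub>R c) \<subseteq> Poly_Mapping.keys c" for r and c :: chain
    by (auto simp: in_keys_iff lookup_scaleR)
  moreover have "Poly_Mapping.keys (b + c) \<subseteq> Poly_Mapping.keys b \<union> Poly_Mapping.keys c" for b c :: chain
    by (rule Poly_Mapping.keys_add)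
  ultimately show ?thesis
    unfolding real_vector.subspace_def chains_def mem_Collect_eq 
    apply (intro conjI allI ballI impI) apply simp apply blast apply blast done
qed

lemma subspace_cycles: "real_vector.subspace (cycles K d)"
  using subspace_chains[of K d]
  unfolding real_vector.subspace_def cycles_def mem_Collect_eq
  by (auto simp only: linear_0[OF linear_boundary] linear_add[OF linear_boundary]
      linear_cmul[OF linear_boundary] add_0 scaleR_zero_right)

lemma subspace_boundaries: "real_vector.subspace (boundaries K d)"
  unfolding boundaries_def by (rule real_vector.linear_subspace_image[OF linear_boundary subspace_chains])

lemma boundaries_subset_cycles:
  assumes K: "\<And>\<sigma> \<tau>. \<sigma> \<in> K \<Longrightarrow> \<tau> \<subseteq> \<sigma> \<Longrightarrow> \<tau> \<noteq> {} \<Longrightarrow> \<tau> \<in> K"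
  shows "boundaries K d \<subseteq> cycles K d"
proof -
  have "boundary c \<in> chains K d" if c: "c \<in> chains K (d + 1)" for c
    unfolding boundary_def simplex_boundary_def scaleR_sum_right scaleR_single
  proof (intro real_vector.subspace_sum[OF subspace_chains])
    fix \<sigma> v assume "\<sigma> \<in> Poly_Mapping.keys c" and v: "v \<in> \<sigma>"
    then have \<sigma>: "\<sigma> \<in> insert {} K" "finite \<sigma>" "int (card \<sigma>) = d + 2"
      using c by (auto simp: chains_def)
    have "\<sigma> - {v} \<in> insert {} K" using \<sigma>(1) v K[of \<sigma> "\<sigma> - {v}"] by auto
    moreover have "card \<sigma> > 0" using v \<sigma>(2) by (auto simp: card_gt_0_iff)
    then have "int (card (\<sigma> - {v})) = d + 1" using v \<sigma> by (simp add: of_nat_diff)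
    ultimately show "Poly_Mapping.single (\<sigma> - {v}) (Poly_Mapping.lookup c \<sigma> * (- 1) ^ card {w \<in> \<sigma>. w < v})
        \<in> chains K d"
      using \<sigma>(2) by (simp add: chains_def)
  qed
  then show ?thesis by (auto simp: boundaries_def cycles_def boundary_boundary)
qed

lemma homology_vectorspace:
  assumes "\<And>\<sigma> \<tau>. \<sigma> \<in> K \<Longrightarrow> \<tau> \<subseteq> \<sigma> \<Longrightarrow> \<tau> \<noteq> {} \<Longrightarrow> \<tau> \<in> K"
  shows "vectorspace class_ring (homology K d)"
  unfolding homology_def
  by (rule quotient_space_vectorspace[OF subspace_cycles subspace_boundaries
      boundaries_subset_cycles[OF assms]])

end

theory Submission
  imports Defs
begin

text \<open>
  The proof is a quantitative form of Garland's method. A real \<open>k\<close>-cycle \<open>f\<close> orthogonal to all boundaries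
  satisfies \<open>\<Sum>\<^sub>\<sigma> d\<^sub>\<sigma> f\<^sub>\<sigma>\<^sup>2 = \<Sum>\<^sub>\<tau> \<langle>f\<^sub>\<tau>, A\<^sub>\<tau> f\<^sub>\<tau>\<rangle>\<close>, where \<open>d\<^sub>\<sigma>\<close> is the number of cofaces of \<open>\<sigma>\<close>, \<open>A\<^sub>\<tau>\<close> is the
  adjacency matrix of the link graph of the \<open>(k-1)\<close>-face \<open>\<tau>\<close>, and \<open>f\<^sub>\<tau>\<close> is the localization of \<open>f\<close>.
  As \<open>f\<^sub>\<tau>\<close> sums to 0, the matrix \<open>A\<^sub>\<tau>\<close> may be centred. Bounding the quadratic form of the centred
  matrix by that of a high power and summing over an orthonormal basis of such cycles bounds \<open>\<beta>\<^sub>k\<close> by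
  the number of faces of small degree plus the Hilbert-Schmidt norms of powers of centred matrices.
  The link graph of \<open>\<tau>\<close> is an Erdos-Renyi graph with average degree about \<open>n r\<^sub>k\<close>, so both terms have
  expectation \<open>O(n\<^sup>k\<^sup>+\<^sup>1 q\<^sub>k (n r\<^sub>k)\<^sup>-\<^sup>t)\<close>: the first by a Chernoff bound, the second by counting closed walks.
\<close>

section \<open>Orthonormal families of chains\<close>

text \<open>The cycles orthogonal to the boundaries depend on the whole complex, so no estimate for
  a fixed vector applies to them. Summing over an orthonormal basis removes this dependence:
  Bessel's inequality bounds the contribution of the basis to one row of a matrix power by the
  squared norm of that row, which involves no cycle. Only expectations are then needed; no spectral
  gap has to hold in all links at once, and no union bound enters.

  The exponent arises as follows. The local bound has a prefactor of order (n r_k)^(-2t). A closed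
  walk of length 2t whose edges all repeat has i \<le> t + 1 vertices, and these walks contribute
  about q_k n (n r_k)^(i - 1) per link. For n r_k \<ge> 1 the net gain is (n r_k)^(-t); for n r_k <
  1 the number of faces suffices as soon as C \<ge> 1.

  Membership in the link of \<tau> is made accessible by sorting the coins according to the part of
  the face outside \<tau>. Coins with different parts form disjoint, hence independent groups, so
  the weight of a walk is a product of independent factors.\<close>

definition chain_inner :: "nat set set \<Rightarrow> chain \<Rightarrow> chain \<Rightarrow> real" where
  "chain_inner F x y = (\<Sum>\<sigma>\<in>F. Poly_Mapping.lookup x \<sigma> * Poly_Mapping.lookup y \<sigma>)"

lemma chain_inner_add_left: "chain_inner F (x + y) z = chain_inner F x z + chain_inner F y z"
  by (simp add: chain_inner_def lookup_add algebra_simps sum.distrib)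

lemma chain_inner_scale_left: "chain_inner F (a *\<^sub>R x) z = a * chain_inner F x z"
  by (simp add: chain_inner_def lookup_scaleR algebra_simps sum_distrib_left)

lemma chain_inner_commute: "chain_inner F x y = chain_inner F y x"
  by (simp add: chain_inner_def mult.commute)

lemma linear_chain_inner: "linear (\<lambda>x. chain_inner F x z)"
  by (rule linearI) (simp_all add: chain_inner_add_left chain_inner_scale_left)

definition orthonormal :: "nat set set \<Rightarrow> chain set \<Rightarrow> bool" where
  "orthonormal F T \<longleftrightarrow> finite T \<and> (\<forall>x\<in>T. \<forall>y\<in>T. chain_inner F x y = of_bool (x = y))"

lemma orthonormal_residual:
  assumes "orthonormal F T" "y \<in> T"
  shows "chain_inner F (x - (\<Sum>t\<in>T. chain_inner F x t *\<^sub>R t)) y = 0"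
proof -
  have "chain_inner F (\<Sum>t\<in>T. chain_inner F x t *\<^sub>R t) y
      = (\<Sum>t\<in>T. chain_inner F x t * of_bool (t = y))"
    using assms unfolding orthonormal_def
    by (simp add: linear_sum[OF linear_chain_inner] chain_inner_scale_left)
  also have "\<dots> = chain_inner F x y"
    using assms by (simp add: orthonormal_def if_distrib cong: if_cong)
  finally show ?thesis
    by (simp add: linear_diff[OF linear_chain_inner])
qed

text \<open>Here \<open>h\<close> is the projection of \<open>g\<close> to the span of
  \<open>T\<close>. Its pairing with \<open>g\<close> and its squared norm both equal the sum of the
  squared coefficients, so that sum is what \<open>g - h\<close> loses. The vector \<open>g\<close>
  is a plain function because it will be a row of a matrix.\<close>

lemma bessel:
  assumes T: "orthonormal F T" and "finite F"
  shows "(\<Sum>t\<in>T. (\<Sum>\<sigma>\<in>F. Poly_Mapping.lookup t \<sigma> * g \<sigma>)\<^sup>2) \<le> (\<Sum>\<sigma>\<in>F. (g \<sigma>)\<^sup>2)"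
proof -
  define c where "c t = (\<Sum>\<sigma>\<in>F. Poly_Mapping.lookup t \<sigma> * g \<sigma>)" for t
  define h where "h \<sigma> = (\<Sum>t\<in>T. c t * Poly_Mapping.lookup t \<sigma>)" for \<sigma>
  have gh: "(\<Sum>\<sigma>\<in>F. g \<sigma> * h \<sigma>) = (\<Sum>t\<in>T. (c t)\<^sup>2)"
  proof -
    have "(\<Sum>\<sigma>\<in>F. g \<sigma> * h \<sigma>) = (\<Sum>\<sigma>\<in>F. \<Sum>t\<in>T. c t * (Poly_Mapping.lookup t \<sigma> * g \<sigma>))"
      by (simp add: h_def sum_distrib_left ac_simps)
    also have "\<dots> = (\<Sum>t\<in>T. c t * c t)"
      by (subst sum.swap) (simp add: c_def sum_distrib_left)
    finally show ?thesis by (simp add: power2_eq_square)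
  qed
  have hh: "(\<Sum>\<sigma>\<in>F. h \<sigma> * h \<sigma>) = (\<Sum>t\<in>T. (c t)\<^sup>2)"
  proof -
    have "(\<Sum>\<sigma>\<in>F. h \<sigma> * h \<sigma>)
        = (\<Sum>\<sigma>\<in>F. \<Sum>t\<in>T. \<Sum>u\<in>T. c t * c u * (Poly_Mapping.lookup t \<sigma> * Poly_Mapping.lookup u \<sigma>))"
      by (simp add: h_def sum_product ac_simps)
    also have "\<dots> = (\<Sum>t\<in>T. \<Sum>u\<in>T. c t * c u * chain_inner F t u)"
      by (subst sum.swap, intro sum.cong refl, subst sum.swap) (simp add: chain_inner_def sum_distrib_left)
    also have "\<dots> = (\<Sum>t\<in>T. c t * c t)"
      using T by (intro sum.cong refl) (simp add: orthonormal_def if_distrib cong: if_cong)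
    finally show ?thesis by (simp add: power2_eq_square)
  qed
  have "0 \<le> (\<Sum>\<sigma>\<in>F. (g \<sigma> - h \<sigma>)\<^sup>2)" by (simp add: sum_nonneg)
  also have "\<dots> = (\<Sum>\<sigma>\<in>F. (g \<sigma>)\<^sup>2) - 2 * (\<Sum>\<sigma>\<in>F. g \<sigma> * h \<sigma>) + (\<Sum>\<sigma>\<in>F. h \<sigma> * h \<sigma>)"
    unfolding sum_distrib_left sum_subtractf[symmetric] sum.distrib[symmetric]
    by (intro sum.cong refl) (simp add: power2_eq_square algebra_simps)
  finally show ?thesis unfolding gh hh by (simp add: c_def)
qed

text \<open>Test against the indicator of \<open>\<sigma>\<close>. This is what limits the influence
  of a single face of small degree, whatever the family is.\<close>

lemma bessel_coordinate:
  assumes T: "orthonormal F T" and "finite F" "\<sigma> \<in> F"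
  shows "(\<Sum>t\<in>T. (Poly_Mapping.lookup t \<sigma>)\<^sup>2) \<le> 1"
  using bessel[OF T \<open>finite F\<close>, of "\<lambda>\<rho>. if \<rho> = \<sigma> then 1 else 0"] assms(2,3)
  by (simp add: if_distrib[of "\<lambda>x. x\<^sup>2"] if_distrib[of "(*) _"] cong: if_cong)

lemma card_orthonormal:
  assumes T: "orthonormal F T"
  shows "real (card T) = (\<Sum>t\<in>T. \<Sum>\<sigma>\<in>F. (Poly_Mapping.lookup t \<sigma>)\<^sup>2)"
proof -
  have "(\<Sum>\<sigma>\<in>F. (Poly_Mapping.lookup t \<sigma>)\<^sup>2) = 1" if "t \<in> T" for t
    using T that by (auto simp: orthonormal_def chain_inner_def power2_eq_square)
  then show ?thesis by simp
qed

lemma card_orthonormal_le: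
  assumes "orthonormal F T" "finite F"
  shows "card T \<le> card F"
proof -
  have "real (card T) = (\<Sum>\<sigma>\<in>F. \<Sum>t\<in>T. (Poly_Mapping.lookup t \<sigma>)\<^sup>2)"
    unfolding card_orthonormal[OF assms(1)] by (rule sum.swap)
  also have "\<dots> \<le> (\<Sum>\<sigma>\<in>F. 1)"
    by (intro sum_mono bessel_coordinate[OF assms])
  finally show ?thesis by simp
qed

text \<open>Bessel bounds the size of every orthonormal family by \<open>card F\<close>, so a
  largest one between \<open>S\<close> and \<open>Z\<close> exists. It spans, since otherwise a
  normalised Gram-Schmidt residual could be added. The support hypothesis makes
  \<open>chain_inner F\<close> definite on \<open>Z\<close>, so that the residual has positive
  norm.\<close>

lemma orthonormal_extend:
  assumes F: "finite F" and Z: "real_vector.subspace Z"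
    and supp: "\<And>z. z \<in> Z \<Longrightarrow> Poly_Mapping.keys z \<subseteq> F"
    and S: "orthonormal F S" "S \<subseteq> Z"
  obtains T where "orthonormal F T" "S \<subseteq> T" "T \<subseteq> Z" "span T = Z"
proof -
  let ?P = "\<lambda>T. orthonormal F T \<and> S \<subseteq> T \<and> T \<subseteq> Z"
  have "\<exists>T. ?P T \<and> (\<forall>T'. ?P T' \<longrightarrow> card T' \<le> card T)"
    by (rule ex_has_greatest_nat[of ?P S card "Suc (card F)"])
      (use S card_orthonormal_le[OF _ F] in \<open>auto simp: less_Suc_eq_le\<close>)
  then obtain T where T: "?P T" and max: "\<And>T'. ?P T' \<Longrightarrow> card T' \<le> card T" by blast
  have "x \<in> span T" if x: "x \<in> Z" for x
  proof (rule ccontr)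
    assume "x \<notin> span T"
    define w where "w = (\<Sum>t\<in>T. chain_inner F x t *\<^sub>R t)"
    define y where "y = x - w"
    have wT: "w \<in> span T"
      unfolding w_def by (intro span_sum span_scale span_base)
    have "y \<noteq> 0" using wT \<open>x \<notin> span T\<close> by (auto simp: y_def)
    have "span T \<subseteq> Z" using T Z by (intro span_minimal) auto
    then have yZ: "y \<in> Z"
      unfolding y_def using wT x by (intro real_vector.subspace_diff[OF Z]) auto
    obtain \<sigma> where \<sigma>: "Poly_Mapping.lookup y \<sigma> \<noteq> 0"
      using \<open>y \<noteq> 0\<close> by (metis lookup_zero poly_mapping_eqI)
    then have "\<sigma> \<in> F" using supp[OF yZ] by (auto simp: in_keys_iff)
    then have pos: "0 < chain_inner F y y"
      unfolding chain_inner_def using F \<sigma>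
      by (intro sum_pos2[of _ \<sigma>]) (auto simp: zero_less_mult_iff linorder_neq_iff)
    have orth: "chain_inner F y t = 0" if "t \<in> T" for t
      unfolding y_def w_def using T that by (intro orthonormal_residual) auto
    define u where "u = (1 / sqrt (chain_inner F y y)) *\<^sub>R y"
    have uu: "chain_inner F u u = 1"
      using pos unfolding u_def chain_inner_scale_left
      by (subst chain_inner_commute) (simp add: chain_inner_scale_left)
    have ut: "chain_inner F u t = 0" if "t \<in> T" for t
      using orth[OF that] by (simp add: u_def chain_inner_scale_left)
    have tu: "chain_inner F t u = 0" if "t \<in> T" for t
      using ut[OF that] by (simp add: chain_inner_commute)
    have "u \<notin> T" using uu ut by force
    have "?P (insert u T)"
      using T uu ut tu yZ \<open>u \<notin> T\<close>
      by (auto simp: orthonormal_def u_def intro!: real_vector.subspace_scale[OF Z])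
    from max[OF this] show False
      using T \<open>u \<notin> T\<close> by (simp add: orthonormal_def)
  qed
  moreover have "span T \<subseteq> Z" using T Z by (intro span_minimal) auto
  ultimately show ?thesis using T that by blast
qed

section \<open>Harmonic representatives of homology\<close>

text \<open>An upper bound on the dimension requires only generators. The \<open>x\<close> whose
  coset lies in the span of the cosets of \<open>T\<close> form a real subspace containing
  \<open>T\<close> and \<open>B\<close>; this carries generation from the type-class
  \<open>span\<close> to the span of the vector space record.\<close>

lemma dim_quotient_space_le:
  fixes Z B T :: "'v::real_vector set"
  assumes Z: "real_vector.subspace Z" and B: "real_vector.subspace B" and "B \<subseteq> Z"
    and T: "finite T" "T \<subseteq> Z" and gen: "Z \<subseteq> span (T \<union> B)"
  shows "vectorspace.dim class_ring (quotient_space Z B) \<le> card T"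
proof -
  let ?Q = "quotient_space Z B" and ?q = "\<lambda>z. (+) z ` B"
  interpret vectorspace class_ring ?Q
    by (rule quotient_space_vectorspace) fact+
  have add: "add ?Q (?q x) (?q y) = ?q (x + y)" for x y
    by (simp add: quotient_space_def coset_add[OF B])
  have smult: "smult ?Q a (?q x) = ?q (a *\<^sub>R x)" for x a
    by (simp add: quotient_space_def coset_scale[OF B])
  have c: "carrier ?Q = ?q ` Z" by (simp add: quotient_space_def)
  have z: "zero ?Q = ?q 0" by (simp add: quotient_space_def)
  have sub: "?q ` T \<subseteq> carrier ?Q" unfolding c using T by blast
  let ?S = "LinearCombinations.module.span class_ring ?Q (?q ` T)"
  have sm: "submodule class_ring ?S ?Q" by (rule span_is_submodule[OF sub])
  have S0: "?q 0 \<in> ?S" unfolding z[symmetric] using submodule.zero_closed[OF sm] .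
  have "real_vector.subspace {x. ?q x \<in> ?S}"
  proof (rule real_vector.subspaceI)
    show "0 \<in> {x. ?q x \<in> ?S}" using S0 by simp
  next
    fix x y assume "x \<in> {x. ?q x \<in> ?S}" "y \<in> {x. ?q x \<in> ?S}"
    then show "x + y \<in> {x. ?q x \<in> ?S}"
      using submodule.m_closed[OF sm, of "?q x" "?q y"] by (simp add: add)
  next
    fix a x assume "x \<in> {x. ?q x \<in> ?S}"
    then show "a *\<^sub>R x \<in> {x. ?q x \<in> ?S}"
      using submodule.smult_closed[OF sm, of a "?q x"] by (simp add: smult)
  qed
  moreover have "T \<union> B \<subseteq> {x. ?q x \<in> ?S}"
  proof -
    have "?q b = ?q 0" if "b \<in> B" for b using that coset_eq_iff[OF B, of b 0] by simp
    moreover have "?q t \<in> ?S" if "t \<in> T" for t using in_own_span[OF sub] that by blast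
    ultimately show ?thesis using S0 by auto
  qed
  ultimately have "Z \<subseteq> {x. ?q x \<in> ?S}"
    by (intro order_trans[OF gen real_vector.span_minimal])
  then have "carrier ?Q \<subseteq> ?S" unfolding c by auto
  moreover have "?S \<subseteq> carrier ?Q" using span_is_subset2[OF sub] .
  ultimately have "gen_set (?q ` T)" by auto
  then have "dim \<le> card (?q ` T)" using T sub by (intro gen_ge_dim) auto
  also have "\<dots> \<le> card T" using T by (intro card_image_le)
  finally show ?thesis .
qed

text \<open>An orthonormal basis \<open>S\<close> of the boundaries is extended to one of the
  cycles. What is added is automatically orthogonal to all boundaries and generates the cycles
  modulo the boundaries.\<close>

lemma betti_le_card_harmonic:
  assumes K: "\<And>\<sigma> \<tau>. \<sigma> \<in> K \<Longrightarrow> \<tau> \<subseteq> \<sigma> \<Longrightarrow> \<tau> \<noteq> {} \<Longrightarrow> \<tau> \<in> K" and fin: "finite K"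
  obtains T where "orthonormal {\<sigma> \<in> K. finite \<sigma> \<and> card \<sigma> = k + 1} T" "T \<subseteq> cycles K (int k)"
    "\<forall>t\<in>T. \<forall>b\<in>boundaries K (int k).
      chain_inner {\<sigma> \<in> K. finite \<sigma> \<and> card \<sigma> = k + 1} t b = 0"
    "betti (int k) K \<le> card T"
proof -
  let ?F = "{\<sigma> \<in> K. finite \<sigma> \<and> card \<sigma> = k + 1}"
  let ?Z = "cycles K (int k)" and ?B = "boundaries K (int k)"
  have F: "finite ?F" using fin by simp
  have BZ: "?B \<subseteq> ?Z" by (rule boundaries_subset_cycles[OF K])
  have supp: "Poly_Mapping.keys z \<subseteq> ?F" if "z \<in> ?Z" for z
    using that by (fastforce simp: cycles_def chains_def)
  have "orthonormal ?F {}" by (simp add: orthonormal_def)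
  obtain S where S: "orthonormal ?F S" "S \<subseteq> ?B" "span S = ?B"
    by (rule orthonormal_extend[OF F subspace_boundaries _ \<open>orthonormal ?F {}\<close>, of K "int k"])
      (use BZ supp in auto)
  obtain T where T: "orthonormal ?F T" "S \<subseteq> T" "T \<subseteq> ?Z" "span T = ?Z"
    by (rule orthonormal_extend[OF F subspace_cycles supp S(1)])
      (use S BZ in auto)
  have fT: "finite T" using T by (simp add: orthonormal_def)
  show ?thesis
  proof (rule that[of "T - S"])
    show "orthonormal ?F (T - S)" using T by (auto simp: orthonormal_def)
    show "T - S \<subseteq> ?Z" using T by auto
    have "chain_inner ?F t b = 0" if "t \<in> T - S" "b \<in> ?B" for t b
    proof -
      have "b \<in> span S" using that S by simp
      then have "chain_inner ?F b t = 0"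
      proof (rule span_induct)
        show "real_vector.subspace {b. chain_inner ?F b t = 0}"
          by (rule real_vector.subspaceI)
            (auto simp: chain_inner_add_left chain_inner_scale_left linear_0[OF linear_chain_inner])
        show "chain_inner ?F b t = 0" if "b \<in> S" for b
          using that \<open>t \<in> T - S\<close> T by (auto simp: orthonormal_def)
      qed
      then show ?thesis by (simp add: chain_inner_commute)
    qed
    then show "\<forall>t\<in>T - S. \<forall>b\<in>?B. chain_inner ?F t b = 0" by blast
    have "T \<subseteq> (T - S) \<union> ?B" using S by auto
    then have "?Z \<subseteq> span ((T - S) \<union> ?B)"
      using T(4) span_mono by blast
    then show "betti (int k) K \<le> card (T - S)"
      unfolding betti_def homology_def using fT T
      by (intro dim_quotient_space_le subspace_cycles subspace_boundaries BZ) auto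
  qed
qed

lemma betti_le_card_faces:
  assumes K: "\<And>\<sigma> \<tau>. \<sigma> \<in> K \<Longrightarrow> \<tau> \<subseteq> \<sigma> \<Longrightarrow> \<tau> \<noteq> {} \<Longrightarrow> \<tau> \<in> K" and fin: "finite K"
  shows "betti (int k) K \<le> card {\<sigma> \<in> K. finite \<sigma> \<and> card \<sigma> = k + 1}"
proof -
  let ?F = "{\<sigma> \<in> K. finite \<sigma> \<and> card \<sigma> = k + 1}"
  obtain T where T: "orthonormal ?F T" "T \<subseteq> cycles K (int k)"
    "\<forall>t\<in>T. \<forall>b\<in>boundaries K (int k). chain_inner ?F t b = 0"
    "betti (int k) K \<le> card T"
    by (rule betti_le_card_harmonic[OF K fin, where k = k])
  have "card T \<le> card ?F"
    using fin by (intro card_orthonormal_le[OF T(1)]) auto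
  with T(4) show ?thesis by simp
qed

section \<open>Symmetric matrices and closed walks\<close>

definition inner_on :: "'a set \<Rightarrow> ('a \<Rightarrow> real) \<Rightarrow> ('a \<Rightarrow> real) \<Rightarrow> real" where
  "inner_on N x y = (\<Sum>u\<in>N. x u * y u)"

lemma inner_on_young:
  assumes "\<epsilon> > 0"
  shows "inner_on N x y \<le> \<epsilon> / 2 * inner_on N x x + 1 / (2 * \<epsilon>) * inner_on N y y"
proof -
  have "a * b \<le> \<epsilon> / 2 * (a * a) + 1 / (2 * \<epsilon>) * (b * b)" for a b :: real
  proof -
    have "0 \<le> (\<epsilon> * a - b)\<^sup>2 / (2 * \<epsilon>)" using assms by simp
    also have "\<dots> = \<epsilon> / 2 * (a * a) + 1 / (2 * \<epsilon>) * (b * b) - a * b"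
      using assms by (simp add: power2_eq_square field_simps)
    finally show ?thesis by simp
  qed
  then show ?thesis
    unfolding inner_on_def sum_distrib_left sum.distrib[symmetric] by (intro sum_mono)
qed

lemma inner_on_nonneg: "0 \<le> inner_on N x x"
  by (simp add: inner_on_def sum_nonneg)

text \<open>For an eigenvalue \<open>\<lambda>\<close> of \<open>L\<close> this reads \<open>\<lambda> \<le> \<epsilon> + \<epsilon> (\<lambda> / \<epsilon>) ^ (2 * 2 ^ j)\<close>. Powers of two allow
  an induction that squares the operator, so that no spectral theorem is needed.\<close>

lemma self_adjoint_quadratic_form_le:
  fixes L :: "('a \<Rightarrow> real) \<Rightarrow> 'a \<Rightarrow> real"
  assumes "\<And>x y. inner_on N x (L y) = inner_on N (L x) y" "\<epsilon> > 0"
  shows "inner_on N x (L x) \<le> \<epsilon> * inner_on N x x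
    + \<epsilon> / \<epsilon> ^ (2 * 2 ^ j) * inner_on N ((L ^^ (2 ^ j)) x) ((L ^^ (2 ^ j)) x)"
  using assms
proof (induction j arbitrary: L \<epsilon>)
  case 0
  have "inner_on N x (L x) \<le> \<epsilon> / 2 * inner_on N x x + 1 / (2 * \<epsilon>) * inner_on N (L x) (L x)"
    by (rule inner_on_young) fact
  also have "\<dots> \<le> \<epsilon> * inner_on N x x + 1 / \<epsilon> * inner_on N (L x) (L x)"
    using \<open>\<epsilon> > 0\<close> by (intro add_mono mult_right_mono inner_on_nonneg) (auto simp: field_simps)
  finally show ?case using \<open>\<epsilon> > 0\<close> by (simp add: power2_eq_square)
next
  case (Suc j)
  let ?y = "(L ^^ (2 ^ Suc j)) x"
  have LL: "((L \<circ> L) ^^ (2 ^ j)) x = ?y"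
  proof -
    have "(L \<circ> L) ^^ n = L ^^ (2 * n)" for n
      using funpow_mult[where f = L and m = 2 and n = n] by (simp add: numeral_2_eq_2 mult.commute o_def)
    then show ?thesis by simp
  qed
  \<comment> \<open>The tolerance for the squared operator is \<open>\<epsilon>\<^sup>2\<close>: the
    factor \<open>1 / (2 * \<epsilon>)\<close> of Young's inequality turns it into
    \<open>\<epsilon> / 2\<close>, which together with the other \<open>\<epsilon> / 2\<close>
    closes the induction at exactly \<open>\<epsilon>\<close>.\<close>
  have "inner_on N x ((L \<circ> L) x) \<le> \<epsilon>\<^sup>2 * inner_on N x x
      + \<epsilon>\<^sup>2 / \<epsilon>\<^sup>2 ^ (2 * 2 ^ j) * inner_on N ?y ?y"
    unfolding LL[symmetric] by (rule Suc.IH) (use Suc.prems in auto)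
  then have *: "inner_on N (L x) (L x) \<le> \<epsilon>\<^sup>2 * inner_on N x x
      + \<epsilon>\<^sup>2 / \<epsilon>\<^sup>2 ^ (2 * 2 ^ j) * inner_on N ?y ?y"
    using Suc.prems(1) by simp
  have "inner_on N x (L x) \<le> \<epsilon> / 2 * inner_on N x x + 1 / (2 * \<epsilon>) * inner_on N (L x) (L x)"
    by (rule inner_on_young) fact
  also have "\<dots> \<le> \<epsilon> / 2 * inner_on N x x + 1 / (2 * \<epsilon>) * (\<epsilon>\<^sup>2 * inner_on N x x
      + \<epsilon>\<^sup>2 / \<epsilon>\<^sup>2 ^ (2 * 2 ^ j) * inner_on N ?y ?y)"
    using Suc.prems(2) by (intro add_left_mono mult_left_mono *) auto
  also have "\<dots> = \<epsilon> * inner_on N x x + (\<epsilon> / \<epsilon> ^ (2 * 2 ^ Suc j)) / 2 * inner_on N ?y ?y"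
  proof -
    have "1 / (2 * \<epsilon>) * (\<epsilon>\<^sup>2 / \<epsilon>\<^sup>2 ^ (2 * 2 ^ j)) = (\<epsilon> / \<epsilon> ^ (2 * 2 ^ Suc j)) / 2"
    proof -
      have "\<epsilon>\<^sup>2 ^ (2 * 2 ^ j) = \<epsilon> ^ (2 * 2 ^ Suc j)" by (simp flip: power_mult)
      then show ?thesis
        using Suc.prems(2) by (simp add: power2_eq_square)
    qed
    moreover have "1 / (2 * \<epsilon>) * \<epsilon>\<^sup>2 = \<epsilon> / 2"
      using Suc.prems(2) by (simp add: power2_eq_square)
    ultimately show ?thesis
      by (simp only: distrib_left mult.assoc[symmetric])
  qed
  also have "\<dots> \<le> \<epsilon> * inner_on N x x + (\<epsilon> / \<epsilon> ^ (2 * 2 ^ Suc j)) * inner_on N ?y ?y"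
  proof -
    have "z / 2 \<le> z" if "0 \<le> z" for z :: real using that by simp
    from this[of "\<epsilon> / \<epsilon> ^ (2 * 2 ^ Suc j)"] show ?thesis
      using Suc.prems(2) by (intro add_left_mono mult_right_mono inner_on_nonneg) simp
  qed
  finally show ?case .
qed

section \<open>Matrix powers as sums over walks\<close>

definition apply_mat :: "'a set \<Rightarrow> ('a \<Rightarrow> 'a \<Rightarrow> real) \<Rightarrow> ('a \<Rightarrow> real) \<Rightarrow> 'a \<Rightarrow> real" where
  "apply_mat N S x u = (\<Sum>v\<in>N. S u v * x v)"

primrec mat_pow :: "'a set \<Rightarrow> ('a \<Rightarrow> 'a \<Rightarrow> real) \<Rightarrow> nat \<Rightarrow> 'a \<Rightarrow> 'a \<Rightarrow> real" where
  "mat_pow N S 0 = (\<lambda>u w. of_bool (u = w))"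
| "mat_pow N S (Suc m) = (\<lambda>u w. \<Sum>v\<in>N. S u v * mat_pow N S m v w)"

lemma apply_mat_self_adjoint:
  assumes "\<And>u v. S u v = S v u"
  shows "inner_on N x (apply_mat N S y) = inner_on N (apply_mat N S x) y"
  unfolding inner_on_def apply_mat_def sum_distrib_left sum_distrib_right
  by (subst sum.swap) (simp add: assms ac_simps)

lemma funpow_apply_mat:
  assumes "finite N" "u \<in> N"
  shows "(apply_mat N S ^^ m) x u = (\<Sum>w\<in>N. mat_pow N S m u w * x w)"
  using assms(2)
proof (induction m arbitrary: u)
  case 0
  then show ?case using assms(1) by (simp add: of_bool_def if_distrib[of "\<lambda>a. a * _"] cong: if_cong)
next
  case (Suc m)
  have "(apply_mat N S ^^ Suc m) x u = (\<Sum>v\<in>N. S u v * (apply_mat N S ^^ m) x v)"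
    by (simp add: apply_mat_def)
  also have "\<dots> = (\<Sum>v\<in>N. \<Sum>w\<in>N. S u v * (mat_pow N S m v w * x w))"
    using Suc.IH by (simp add: sum_distrib_left)
  also have "\<dots> = (\<Sum>w\<in>N. mat_pow N S (Suc m) u w * x w)"
    by (subst sum.swap) (simp add: sum_distrib_right mult.assoc)
  finally show ?case .
qed

lemma mat_pow_add:
  assumes "finite N" "u \<in> N"
  shows "mat_pow N S (a + b) u w = (\<Sum>v\<in>N. mat_pow N S a u v * mat_pow N S b v w)"
  using assms(2)
proof (induction a arbitrary: u)
  case 0
  then show ?case using assms(1) by (simp add: of_bool_def if_distrib[of "\<lambda>a. a * _"] cong: if_cong)
next
  case (Suc a)
  have "mat_pow N S (Suc a + b) u w
      = (\<Sum>z\<in>N. \<Sum>v\<in>N. S u z * (mat_pow N S a z v * mat_pow N S b v w))"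
    using Suc.IH by (simp add: sum_distrib_left)
  also have "\<dots> = (\<Sum>v\<in>N. mat_pow N S (Suc a) u v * mat_pow N S b v w)"
    by (subst sum.swap) (simp add: sum_distrib_right mult.assoc)
  finally show ?case .
qed

lemma mat_pow_sym:
  assumes "finite N" "\<And>u v. S u v = S v u" "u \<in> N" "w \<in> N"
  shows "mat_pow N S m u w = mat_pow N S m w u"
  using assms(3,4)
proof (induction m arbitrary: u w)
  case (Suc m)
  have one: "mat_pow N S 1 v w = S v w" if "w \<in> N" for v w
    using assms(1) that by (simp add: of_bool_def if_distrib[of "(*) _"] cong: if_cong)
  have "mat_pow N S (Suc m) u w = mat_pow N S (m + 1) u w" by simp
  also have "\<dots> = (\<Sum>v\<in>N. mat_pow N S m u v * mat_pow N S 1 v w)"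
    by (rule mat_pow_add) (use assms(1) Suc.prems in auto)
  also have "\<dots> = (\<Sum>v\<in>N. S w v * mat_pow N S m v u)"
    using Suc one by (intro sum.cong refl) (simp add: assms(2)[of w] del: mat_pow.simps)
  finally show ?case by simp
qed auto

definition path_weight :: "('a \<Rightarrow> 'a \<Rightarrow> real) \<Rightarrow> 'a list \<Rightarrow> real" where
  "path_weight S zs = (\<Prod>(x, y)\<leftarrow>zip zs (tl zs). S x y)"

lemma path_weight_Cons2 [simp]: "path_weight S (x # y # zs) = S x y * path_weight S (y # zs)"
  by (simp add: path_weight_def)

lemma path_weight_single [simp]: "path_weight S [x] = 1"
  by (simp add: path_weight_def)

text \<open>The list \<open>xs\<close> holds the interior vertices. The exponent starts at 1 because
  a walk without edges would force \<open>u = w\<close>, which a list with two separate ends cannot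
  express.\<close>

lemma mat_pow_Suc_eq_sum_paths:
  assumes "finite N" "w \<in> N"
  shows "mat_pow N S (Suc m) u w
    = (\<Sum>xs | set xs \<subseteq> N \<and> length xs = m. path_weight S (u # xs @ [w]))"
proof (induction m arbitrary: u)
  case 0
  have "{xs. set xs \<subseteq> N \<and> length xs = 0} = {[]}" by auto
  then show ?case using assms by (simp add: of_bool_def if_distrib[of "(*) _"] cong: if_cong)
next
  case (Suc m)
  let ?L = "\<lambda>m. {xs. set xs \<subseteq> N \<and> length xs = m}"
  have "(\<Sum>xs\<in>?L (Suc m). path_weight S (u # xs @ [w]))
      = (\<Sum>(xs, v)\<in>?L m \<times> N. path_weight S (u # v # xs @ [w]))"
    unfolding lists_length_Suc_eq
    by (subst sum.reindex) (auto simp: inj_on_def o_def case_prod_unfold)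
  also have "\<dots> = (\<Sum>v\<in>N. \<Sum>xs\<in>?L m. path_weight S (u # v # xs @ [w]))"
    by (subst sum.swap) (simp add: sum.cartesian_product)
  also have "\<dots> = (\<Sum>v\<in>N. S u v * mat_pow N S (Suc m) v w)"
    unfolding Suc.IH by (simp add: sum_distrib_left)
  finally show ?case by simp
qed

text \<open>By symmetry the sum of squares is the trace of the power \<open>2 * t\<close>, hence a
  sum over closed walks. A closed walk is stored as its \<open>2 * t\<close> starting points and
  closed up by \<open>hd ys\<close>, which is meaningful because of
  \<open>t \<ge> 1\<close>.\<close>

lemma sum_mat_pow_squares:
  assumes N: "finite N" and sym: "\<And>u v. S u v = S v u" and "t \<ge> 1"
  shows "(\<Sum>u\<in>N. \<Sum>w\<in>N. (mat_pow N S t u w)\<^sup>2)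
    = (\<Sum>ys | set ys \<subseteq> N \<and> length ys = 2 * t. path_weight S (ys @ [hd ys]))"
proof -
  let ?L = "\<lambda>m. {xs. set xs \<subseteq> N \<and> length xs = m}"
  obtain m where m: "2 * t = Suc m" using \<open>t \<ge> 1\<close> by (cases "2 * t") auto
  have "(\<Sum>u\<in>N. \<Sum>w\<in>N. (mat_pow N S t u w)\<^sup>2) = (\<Sum>u\<in>N. mat_pow N S (2 * t) u u)"
    unfolding mult_2 using mat_pow_sym[OF N sym]
    by (intro sum.cong refl) (simp add: mat_pow_add[OF N] power2_eq_square)
  also have "\<dots> = (\<Sum>u\<in>N. \<Sum>xs\<in>?L m. path_weight S (u # xs @ [u]))"
    unfolding m by (intro sum.cong refl mat_pow_Suc_eq_sum_paths N)
  also have "\<dots> = (\<Sum>(xs, u)\<in>?L m \<times> N. path_weight S (u # xs @ [u]))"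
    by (subst sum.swap) (simp add: sum.cartesian_product)
  also have "\<dots> = (\<Sum>ys\<in>?L (2 * t). path_weight S (ys @ [hd ys]))"
    unfolding m lists_length_Suc_eq
    by (subst sum.reindex) (auto simp: inj_on_def o_def case_prod_unfold)
  finally show ?thesis .
qed

section \<open>Edges and vertices of a walk\<close>

text \<open>A list, so that multiplicities survive. A loop shows up as a singleton, which is why
  walks are later tested by \<open>card e = 2\<close>.\<close>

definition path_edges :: "'a list \<Rightarrow> 'a set list" where
  "path_edges zs = map (\<lambda>(x, y). {x, y}) (zip zs (tl zs))"

lemma path_edges_Cons2 [simp]: "path_edges (x # y # zs) = {x, y} # path_edges (y # zs)"
  by (simp add: path_edges_def)

lemma path_edges_single [simp]: "path_edges [x] = []"
  by (simp add: path_edges_def)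

lemma length_path_edges [simp]: "length (path_edges zs) = length zs - 1"
  by (simp add: path_edges_def)

lemma path_edges_subset: "e \<in> set (path_edges zs) \<Longrightarrow> e \<subseteq> set zs"
  by (cases zs) (auto simp: path_edges_def dest: set_zip_leftD set_zip_rightD)

text \<open>A walk is connected: a vertex prepended for the first time brings an edge that contains
  it, and no earlier edge does.\<close>

lemma card_vertices_le_card_edges: "card (set zs) \<le> Suc (card (set (path_edges zs)))"
proof (induction zs rule: induct_list012)
  case (3 x y zs)
  show ?case
  proof (cases "x \<in> set (y # zs)")
    case True
    then have "card (set (x # y # zs)) = card (set (y # zs))" by (simp add: insert_absorb)
    also have "\<dots> \<le> Suc (card (set (path_edges (y # zs))))" by (rule 3)
    also have "\<dots> \<le> Suc (card (set (path_edges (x # y # zs))))"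
      by (auto intro!: card_mono)
    finally show ?thesis .
  next
    case False
    then have "{x, y} \<notin> set (path_edges (y # zs))" using path_edges_subset by fastforce
    then show ?thesis using 3 False by simp
  qed
qed (auto simp: path_edges_def)

lemma prod_list_eq_prod_count:
  "(\<Prod>x\<leftarrow>xs. f x :: 'b::comm_monoid_mult) = (\<Prod>x\<in>set xs. f x ^ count_list xs x)"
proof (induction xs)
  case (Cons a xs)
  show ?case
  proof (cases "a \<in> set xs")
    case True
    have "(\<Prod>x\<in>set xs. f x ^ count_list (a # xs) x)
        = (\<Prod>x\<in>set xs. (if a = x then f x else 1) * f x ^ count_list xs x)"
      by (intro prod.cong) auto
    also have "\<dots> = f a * (\<Prod>x\<in>set xs. f x ^ count_list xs x)"
      unfolding prod.distrib using True by simp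
    finally show ?thesis using Cons True by (simp add: insert_absorb)
  next
    case False
    have "(\<Prod>x\<in>set xs. f x ^ count_list (a # xs) x) = (\<Prod>x\<in>set xs. f x ^ count_list xs x)"
      using False by (intro prod.cong) auto
    then show ?thesis using Cons False by (simp add: count_notin)
  qed
qed simp

lemma twice_card_edges_le:
  assumes "\<And>e. e \<in> set es \<Longrightarrow> count_list es e \<noteq> 1"
  shows "2 * card (set es) \<le> length es"
proof -
  have "2 \<le> count_list es e" if "e \<in> set es" for e
    using assms[OF that] that count_list_0_iff[of es e] by linarith
  then have "(\<Sum>e\<in>set es. 2) \<le> (\<Sum>e\<in>set es. count_list es e)" by (intro sum_mono)
  then show ?thesis by (simp add: sum_count_set)
qed

text \<open>The factors \<open>y0\<close> and \<open>y u\<close> are idempotent, as indicators are,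
  so repeated visits collapse to one factor per vertex, while the factors \<open>g e\<close> keep
  their multiplicity. At least one edge is required, since the weight of a single vertex is 1 and
  shows neither \<open>y0\<close> nor \<open>y\<close>.\<close>

lemma path_weight_factor:
  assumes S: "\<And>u v. S u v = (if u = v then 0 else y0 * y u * y v * g {u, v})"
    and y0: "y0 * y0 = y0" and y: "\<And>u. y u * y u = y u"
    and "length zs \<ge> 2" and "\<And>e. e \<in> set (path_edges zs) \<Longrightarrow> card e = 2"
  shows "path_weight S zs
    = y0 * (\<Prod>u\<in>set zs. y u) * (\<Prod>e\<in>set (path_edges zs). g e ^ count_list (path_edges zs) e)"
  unfolding prod_list_eq_prod_count[symmetric]
  using assms(4,5)
proof (induction zs rule: induct_list012)
  case (3 a b zs)
  have ab: "a \<noteq> b" using 3(4)[of "{a, b}"] by auto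
  show ?case
  proof (cases zs)
    case Nil
    then show ?thesis using ab by (simp add: S)
  next
    case (Cons c zs')
    have "path_weight S (b # zs) = y0 * (\<Prod>u\<in>set (b # zs). y u) * (\<Prod>e\<leftarrow>path_edges (b # zs). g e)"
      using 3 Cons by simp
    then have "path_weight S (a # b # zs) = (y0 * y0) * (y a * y b * (\<Prod>u\<in>set (b # zs). y u))
        * (\<Prod>e\<leftarrow>path_edges (a # b # zs). g e)"
      using ab by (simp add: S ac_simps)
    moreover have "y a * y b * (\<Prod>u\<in>set (b # zs). y u) = (\<Prod>u\<in>set (a # b # zs). y u)"
    proof -
      have absorb: "y v * (\<Prod>u\<in>A. y u) = (\<Prod>u\<in>insert v A. y u)" if "finite A" for v and A
      proof (cases "v \<in> A")
        case True
        then have "(\<Prod>u\<in>A. y u) = y v * (\<Prod>u\<in>A - {v}. y u)"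
          using that by (simp add: prod.remove)
        then show ?thesis
          using True by (simp add: insert_absorb mult.assoc[symmetric] y)
      qed (use that in simp)
      show ?thesis
        by (simp add: mult.assoc absorb del: prod.insert)
    qed
    ultimately show ?thesis by (simp only: y0)
  qed
qed auto

lemma path_weight_eq_0:
  assumes "\<And>u. S u u = 0" "e \<in> set (path_edges zs)" "card e \<noteq> 2"
  shows "path_weight S zs = 0"
proof -
  obtain x y where xy: "(x, y) \<in> set (zip zs (tl zs))" "e = {x, y}"
    using assms(2) by (auto simp: path_edges_def)
  then have "x = y" using assms(3) by (cases "x = y") auto
  then show ?thesis
    using xy assms(1) by (force simp: path_weight_def prod_list_zero_iff)
qed

text \<open>Choose the set of entries, then a word over it. This counts the closed walks by their
  number of distinct vertices.\<close>

lemma card_lists_card_set_le: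
  assumes N: "finite N"
  shows "card {ys. set ys \<subseteq> N \<and> length ys = m \<and> card (set ys) = j} \<le> card N ^ j * j ^ m"
proof -
  have "{ys. set ys \<subseteq> N \<and> length ys = m \<and> card (set ys) = j}
      \<subseteq> (\<Union>A\<in>{A. A \<subseteq> N \<and> card A = j}. {ys. set ys \<subseteq> A \<and> length ys = m})"
    by auto
  then have "card {ys. set ys \<subseteq> N \<and> length ys = m \<and> card (set ys) = j}
      \<le> card (\<Union>A\<in>{A. A \<subseteq> N \<and> card A = j}. {ys. set ys \<subseteq> A \<and> length ys = m})"
    using N by (intro card_mono finite_UN_I finite_lists_length_eq) (auto intro: finite_subset)
  also have "\<dots> \<le> (\<Sum>A | A \<subseteq> N \<and> card A = j. card {ys. set ys \<subseteq> A \<and> length ys = m})"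
    using N by (intro card_UN_le) simp
  also have "\<dots> = (\<Sum>A | A \<subseteq> N \<and> card A = j. j ^ m)"
    using N by (intro sum.cong refl) (auto simp: card_lists_length_eq finite_subset)
  also have "\<dots> = (card N choose j) * j ^ m"
    using N by (simp add: n_subsets)
  also have "\<dots> \<le> card N ^ j * j ^ m"
    by (cases "j \<le> card N") (auto simp: binomial_le_pow binomial_eq_0)
  finally show ?thesis .
qed

section \<open>The random complex as a function of independent coins\<close>

definition nonempty_faces :: "nat \<Rightarrow> nat set set" where
  "nonempty_faces n = Pow {..<n} - {{}}"

lemma finite_nonempty_faces [simp]: "finite (nonempty_faces n)"
  by (simp add: nonempty_faces_def)

lemma nonempty_facesD:
  assumes "\<sigma> \<in> nonempty_faces n"
  shows "finite \<sigma>" "0 < card \<sigma>" "card \<sigma> \<le> n"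
proof -
  show "finite \<sigma>" using assms finite_subset[of \<sigma> "{..<n}"] by (auto simp: nonempty_faces_def)
  then show "0 < card \<sigma>" using assms by (auto simp: nonempty_faces_def card_gt_0_iff)
  show "card \<sigma> \<le> n" using assms card_mono[of "{..<n}" \<sigma>] by (simp add: nonempty_faces_def)
qed

text \<open>A coin is flipped for every possible face, whether or not it ever becomes a candidate.\<close>

definition coins :: "nat \<Rightarrow> (nat \<Rightarrow> real) \<Rightarrow> (nat set \<Rightarrow> bool) pmf" where
  "coins n p = Pi_pmf (nonempty_faces n) False (\<lambda>\<sigma>. bernoulli_pmf (p (card \<sigma> - 1)))"

definition coin_complex :: "nat \<Rightarrow> (nat set \<Rightarrow> bool) \<Rightarrow> nat set set" where
  "coin_complex n c = {\<sigma> \<in> nonempty_faces n. \<forall>\<tau>\<subseteq>\<sigma>. \<tau> \<noteq> {} \<longrightarrow> c \<tau>}"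

lemma coin_complex_closed:
  "\<sigma> \<in> coin_complex n c \<Longrightarrow> \<tau> \<subseteq> \<sigma> \<Longrightarrow> \<tau> \<noteq> {} \<Longrightarrow> \<tau> \<in> coin_complex n c"
  by (auto simp: coin_complex_def nonempty_faces_def)

lemma mem_coin_complex_iff:
  assumes "\<sigma> \<in> nonempty_faces n"
  shows "\<sigma> \<in> coin_complex n c
    \<longleftrightarrow> c \<sigma> \<and> (\<forall>\<tau>. \<tau> \<subset> \<sigma> \<and> \<tau> \<noteq> {} \<longrightarrow> \<tau> \<in> coin_complex n c)"
proof (intro iffI conjI allI impI)
  assume \<sigma>: "\<sigma> \<in> coin_complex n c"
  then show "c \<sigma>" using assms by (simp add: coin_complex_def nonempty_faces_def)
  show "\<tau> \<in> coin_complex n c" if "\<tau> \<subset> \<sigma> \<and> \<tau> \<noteq> {}" for \<tau>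
    using that by (intro coin_complex_closed[OF \<sigma>]) auto
next
  assume *: "c \<sigma> \<and> (\<forall>\<tau>. \<tau> \<subset> \<sigma> \<and> \<tau> \<noteq> {} \<longrightarrow> \<tau> \<in> coin_complex n c)"
  have "c \<tau>" if "\<tau> \<subseteq> \<sigma>" "\<tau> \<noteq> {}" for \<tau>
  proof (cases "\<tau> = \<sigma>")
    case False
    then have "\<tau> \<in> coin_complex n c" using * that by blast
    then show ?thesis using that(2) by (simp add: coin_complex_def)
  qed (use * in simp)
  then show "\<sigma> \<in> coin_complex n c" using assms by (simp add: coin_complex_def)
qed

text \<open>Deferred decisions: a coin matters only if its face becomes a candidate, so flipping it
  beforehand does not change the law. Coins outside the domain of \<open>Pi_pmf\<close> are
  \<open>False\<close>; hence using only the coins of faces with at most \<open>m\<close> vertices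
  truncates the complex exactly where step \<open>m\<close> begins.\<close>

lemma random_skeleton_eq_coins:
  "random_skeleton n p m = map_pmf (\<lambda>c. coin_complex n c)
    (Pi_pmf {\<sigma> \<in> nonempty_faces n. card \<sigma> \<le> m} False (\<lambda>\<sigma>. bernoulli_pmf (p (card \<sigma> - 1))))"
proof (induction m)
  case 0
  have e: "{\<sigma> \<in> nonempty_faces n. card \<sigma> \<le> 0} = {}"
    by (auto dest: nonempty_facesD)
  have "coin_complex n (\<lambda>_. False) = {}"
    by (auto simp: coin_complex_def nonempty_faces_def)
  then show ?case unfolding e by simp
next
  case (Suc m)
  define A where "A = {\<sigma> \<in> nonempty_faces n. card \<sigma> \<le> m}"
  define D where "D = {\<sigma> \<in> nonempty_faces n. card \<sigma> = Suc m}"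
  define b where "b \<sigma> = bernoulli_pmf (p (card \<sigma> - 1))" for \<sigma> :: "nat set"
  have fin: "finite A" "finite D" by (auto simp: A_def D_def)
  have AD: "{\<sigma> \<in> nonempty_faces n. card \<sigma> \<le> Suc m} = A \<union> D" "A \<inter> D = {}"
    by (auto simp: A_def D_def)
  \<comment> \<open>Coins of non-candidates are never consulted, so those of the candidates may be
    drawn as a restriction of coins on all of \<open>D\<close>. The law of the coins then no longer
    depends on \<open>K\<close>.\<close>
  have step: "add_simplices n p m K
      = map_pmf (\<lambda>g. K \<union> {\<sigma> \<in> candidates n m K. g \<sigma>}) (Pi_pmf D False b)" for K
  proof -
    have sub: "candidates n m K \<subseteq> D"
      by (auto simp: candidates_def D_def nonempty_faces_def)
    have "Pi_pmf (candidates n m K) False (\<lambda>_. bernoulli_pmf (p m))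
        = Pi_pmf (candidates n m K) False b"
      by (intro Pi_pmf_cong refl) (auto simp: candidates_def b_def)
    also have "\<dots> = map_pmf (\<lambda>f x. if x \<in> candidates n m K then f x else False) (Pi_pmf D False b)"
      by (rule Pi_pmf_subset[OF fin(2) sub])
    finally show ?thesis
      unfolding add_simplices_def by (simp add: map_pmf_comp cong: conj_cong)
  qed
  have merge: "coin_complex n f \<union> {\<sigma> \<in> candidates n m (coin_complex n f). g \<sigma>}
      = coin_complex n (\<lambda>x. if x \<in> A then f x else g x)"
    if "f \<in> set_pmf (Pi_pmf A False b)" "g \<in> set_pmf (Pi_pmf D False b)" for f g
  proof -
    have f: "x \<in> A" if "f x" for x
      using set_Pi_pmf_subset[OF fin(1), of False b] \<open>f \<in> _\<close> that by auto
    have g: "x \<in> D" if "g x" for x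
      using set_Pi_pmf_subset[OF fin(2), of False b] \<open>g \<in> _\<close> that by auto
    let ?h = "\<lambda>x. if x \<in> A then f x else g x"
    have h: "?h x \<longleftrightarrow> f x \<or> g x" for x
      using f g AD(2) by auto
    have low: "\<sigma> \<in> coin_complex n ?h \<longleftrightarrow> \<sigma> \<in> coin_complex n f" if "\<sigma> \<in> A" for \<sigma>
    proof -
      have "\<tau> \<in> A" if "\<tau> \<subseteq> \<sigma>" "\<tau> \<noteq> {}" for \<tau>
        using that \<open>\<sigma> \<in> A\<close> card_mono[of \<sigma> \<tau>] nonempty_facesD(1)[of \<sigma> n]
        by (auto simp: A_def nonempty_faces_def)
      then show ?thesis by (auto simp: coin_complex_def)
    qed
    have sub: "coin_complex n f \<subseteq> A"
      using f by (auto simp: coin_complex_def nonempty_faces_def)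
    have subh: "coin_complex n ?h \<subseteq> A \<union> D"
      using f g h by (fastforce simp: coin_complex_def nonempty_faces_def)
    have high: "\<sigma> \<in> coin_complex n ?h \<longleftrightarrow> \<sigma> \<in> candidates n m (coin_complex n f) \<and> g \<sigma>"
      if "\<sigma> \<in> D" for \<sigma>
    proof -
      have \<sigma>: "\<sigma> \<subseteq> {..<n}" "\<sigma> \<noteq> {}" "card \<sigma> = Suc m" "finite \<sigma>"
        using that by (auto simp: D_def nonempty_faces_def intro: finite_subset)
      have proper: "\<tau> \<in> A" if "\<tau> \<subset> \<sigma>" "\<tau> \<noteq> {}" for \<tau>
        using that \<sigma> psubset_card_mono[of \<sigma> \<tau>] by (auto simp: A_def nonempty_faces_def)
      have "\<sigma> \<in> coin_complex n ?h \<longleftrightarrow> ?h \<sigma> \<and> (\<forall>\<tau>. \<tau> \<subset> \<sigma> \<and> \<tau> \<noteq> {} \<longrightarrow> \<tau> \<in> coin_complex n ?h)"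
        using that by (intro mem_coin_complex_iff) (simp add: D_def)
      also have "\<dots> \<longleftrightarrow> g \<sigma> \<and> (\<forall>\<tau>. \<tau> \<subset> \<sigma> \<and> \<tau> \<noteq> {} \<longrightarrow> \<tau> \<in> coin_complex n f)"
        using low[OF proper] that AD(2) by auto
      finally show ?thesis using \<sigma> by (auto simp: candidates_def)
    qed
    have "candidates n m (coin_complex n f) \<subseteq> D"
      by (auto simp: candidates_def D_def nonempty_faces_def)
    then show ?thesis using sub subh low high AD(2) by blast
  qed
  have IH: "random_skeleton n p m = map_pmf (coin_complex n) (Pi_pmf A False b)"
    using Suc.IH unfolding A_def b_def .
  have "random_skeleton n p (Suc m)
      = map_pmf (\<lambda>(f, g). coin_complex n f \<union> {\<sigma> \<in> candidates n m (coin_complex n f). g \<sigma>})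
          (pair_pmf (Pi_pmf A False b) (Pi_pmf D False b))"
    by (simp add: IH step pair_pmf_def map_pmf_def bind_assoc_pmf bind_return_pmf)
  also have "\<dots> = map_pmf (\<lambda>(f, g). coin_complex n (\<lambda>x. if x \<in> A then f x else g x))
          (pair_pmf (Pi_pmf A False b) (Pi_pmf D False b))"
  proof (intro map_pmf_cong refl)
    fix q assume "q \<in> set_pmf (pair_pmf (Pi_pmf A False b) (Pi_pmf D False b))"
    then obtain f g where q: "q = (f, g)" "f \<in> set_pmf (Pi_pmf A False b)"
      "g \<in> set_pmf (Pi_pmf D False b)" by auto
    from merge[OF q(2,3)]
    show "(\<lambda>(f, g). coin_complex n f \<union> {\<sigma> \<in> candidates n m (coin_complex n f). g \<sigma>}) q
        = (\<lambda>(f, g). coin_complex n (\<lambda>x. if x \<in> A then f x else g x)) q"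
      by (simp only: q(1) prod.case)
  qed
  also have "\<dots> = map_pmf (coin_complex n) (Pi_pmf (A \<union> D) False b)"
    unfolding Pi_pmf_union[OF fin AD(2)] by (simp add: map_pmf_comp case_prod_unfold)
  finally show ?case unfolding AD(1) b_def .
qed

lemma random_complex_eq_coins: "random_complex n p = map_pmf (coin_complex n) (coins n p)"
proof -
  have "{\<sigma> \<in> nonempty_faces n. card \<sigma> \<le> n} = nonempty_faces n"
    by (auto dest: nonempty_facesD)
  then show ?thesis
    by (simp add: random_complex_def coins_def random_skeleton_eq_coins)
qed

lemma finite_set_pmf_coins: "finite (set_pmf (coins n p))"
  unfolding coins_def by (subst set_Pi_pmf) (auto intro!: finite_PiE_dflt simp: o_def)

lemma integrable_coins [simp]: "integrable (measure_pmf (coins n p)) (f :: _ \<Rightarrow> real)"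
  by (rule integrable_measure_pmf_finite[OF finite_set_pmf_coins])

lemma finite_coin_complex [simp]: "finite (coin_complex n c)"
  by (auto simp: coin_complex_def)

section \<open>Independent groups of coins around a face\<close>

text \<open>For \<open>x\<close> disjoint from \<open>\<tau>\<close> these are the nonempty sets
  whose part outside \<open>\<tau>\<close> is exactly \<open>x\<close>, so that different
  \<open>x\<close> give disjoint groups. The empty set is removed because it has no coin.\<close>

definition coin_group :: "nat set \<Rightarrow> nat set \<Rightarrow> nat set set" where
  "coin_group \<tau> x = (\<lambda>\<alpha>. x \<union> \<alpha>) ` Pow \<tau> - {{}}"

definition heads :: "(nat set \<Rightarrow> bool) \<Rightarrow> nat set set \<Rightarrow> bool" where
  "heads c G \<longleftrightarrow> (\<forall>\<alpha>\<in>G. c \<alpha>)"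

definition group_prob :: "(nat \<Rightarrow> real) \<Rightarrow> nat set set \<Rightarrow> real" where
  "group_prob p G = (\<Prod>\<alpha>\<in>G. p (card \<alpha> - 1))"

lemma coin_prob:
  assumes "\<forall>i<n. 0 \<le> p i \<and> p i \<le> 1" "\<alpha> \<in> nonempty_faces n"
  shows "0 \<le> p (card \<alpha> - 1)" "p (card \<alpha> - 1) \<le> (1 :: real)"
proof -
  have "card \<alpha> - 1 < n" using nonempty_facesD[OF assms(2)] by linarith
  then show "0 \<le> p (card \<alpha> - 1)" "p (card \<alpha> - 1) \<le> 1" using assms(1) by auto
qed

lemma expectation_heads:
  assumes p: "\<forall>i<n. 0 \<le> p i \<and> p i \<le> (1 :: real)" and G: "G \<subseteq> nonempty_faces n"
  shows "measure_pmf.expectation (coins n p) (\<lambda>c. f (heads c G))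
    = group_prob p G * f True + (1 - group_prob p G) * (f False :: real)"
proof -
  have fG: "finite G" using G by (rule finite_subset) simp
  have "measure_pmf.expectation (coins n p) (\<lambda>c. of_bool (heads c G) :: real)
      = measure_pmf.expectation (coins n p)
          (\<lambda>c. \<Prod>\<alpha>\<in>nonempty_faces n. if \<alpha> \<in> G then of_bool (c \<alpha>) else 1)"
  proof (intro arg_cong[of _ _ "measure_pmf.expectation (coins n p)"] ext)
    fix c :: "nat set \<Rightarrow> bool"
    show "of_bool (heads c G)
        = (\<Prod>\<alpha>\<in>nonempty_faces n. if \<alpha> \<in> G then of_bool (c \<alpha>) else 1 :: real)"
    proof (cases "heads c G")
      case False
      then obtain \<alpha> where "\<alpha> \<in> G" "\<not> c \<alpha>" by (auto simp: heads_def)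
      then have "(\<Prod>\<alpha>\<in>nonempty_faces n. if \<alpha> \<in> G then of_bool (c \<alpha>) else 1 :: real) = 0"
        using G by (intro prod_zero bexI[of _ \<alpha>]) auto
      then show ?thesis using False by simp
    qed (auto simp: heads_def intro!: prod.neutral[symmetric])
  qed
  also have "\<dots> = (\<Prod>\<alpha>\<in>nonempty_faces n.
      measure_pmf.expectation (bernoulli_pmf (p (card \<alpha> - 1))) (\<lambda>b. if \<alpha> \<in> G then of_bool b else 1))"
    unfolding coins_def
    by (rule expectation_prod_Pi_pmf) (auto intro!: integrable_measure_pmf_finite)
  also have "\<dots> = (\<Prod>\<alpha>\<in>nonempty_faces n. if \<alpha> \<in> G then p (card \<alpha> - 1) else 1)"
    using coin_prob[OF p] by (intro prod.cong refl) auto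
  also have "\<dots> = group_prob p G"
    using G by (simp add: prod.If_cases Int_absorb1 group_prob_def)
  finally have *: "measure_pmf.expectation (coins n p) (\<lambda>c. of_bool (heads c G)) = group_prob p G" .
  \<comment> \<open>Every function of a truth value is affine in its indicator, so the probability
    of heads determines the expectation.\<close>
  have "(\<lambda>c. f (heads c G)) = (\<lambda>c. f False + (f True - f False) * of_bool (heads c G))"
    by (auto simp: fun_eq_iff)
  then have "measure_pmf.expectation (coins n p) (\<lambda>c. f (heads c G))
      = f False + (f True - f False) * group_prob p G"
    by (simp add: *)
  then show ?thesis by (simp add: algebra_simps)
qed

lemma expectation_prod_heads:
  assumes p: "\<forall>i<n. 0 \<le> p i \<and> p i \<le> (1 :: real)" and I: "finite I"
    and G: "\<And>x. x \<in> I \<Longrightarrow> G x \<subseteq> nonempty_faces n" and disj: "disjoint_family_on G I"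
  shows "measure_pmf.expectation (coins n p) (\<lambda>c. \<Prod>x\<in>I. f x (heads c (G x)))
    = (\<Prod>x\<in>I. group_prob p (G x) * f x True + (1 - group_prob p (G x)) * (f x False :: real))"
proof -
  let ?indep = "prob_space.indep_vars (measure_pmf (coins n p))"
  have ind: "?indep (\<lambda>_. count_space UNIV) (\<lambda>\<alpha> c. c \<alpha>) (nonempty_faces n)"
    unfolding coins_def by (rule indep_vars_Pi_pmf) simp
  \<comment> \<open>The \<open>restrict\<close> exhibits that the factor at \<open>x\<close> reads
    only the coins in \<open>G x\<close>; the value of \<open>heads\<close> is unaffected by
    it.\<close>
  have "?indep (\<lambda>_. borel) (\<lambda>x c. f x (heads (restrict (\<lambda>\<alpha>. c \<alpha>) (G x)) (G x))) I"
  proof (rule prob_space.indep_vars_compose2[OF prob_space_measure_pmf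
      prob_space.indep_vars_restrict[OF prob_space_measure_pmf ind G disj]])
    fix x assume "x \<in> I"
    then have "finite (G x)" using G finite_subset[of "G x" "nonempty_faces n"] by simp
    then have "Measurable.pred (Pi\<^sub>M (G x) (\<lambda>_. count_space UNIV)) (\<lambda>c. heads c (G x))"
      unfolding heads_def by (intro pred_intros_finite(3)) (auto intro: measurable_component_singleton)
    then show "(\<lambda>c. f x (heads c (G x))) \<in> borel_measurable (Pi\<^sub>M (G x) (\<lambda>_. count_space UNIV))"
      by (rule measurable_compose) simp
  qed
  moreover have "heads (restrict (\<lambda>\<alpha>. c \<alpha>) (G x)) (G x) = heads c (G x)" for c x
    by (simp add: heads_def)
  ultimately have "?indep (\<lambda>_. borel) (\<lambda>x c. f x (heads c (G x))) I" by simp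
  from prob_space.indep_vars_lebesgue_integral[OF prob_space_measure_pmf I this] show ?thesis
    using expectation_heads[OF p G] by simp
qed

lemma coin_group_subset:
  assumes "\<tau> \<subseteq> {..<n}" "x \<subseteq> {..<n}"
  shows "coin_group \<tau> x \<subseteq> nonempty_faces n"
  using assms by (auto simp: coin_group_def nonempty_faces_def)

lemma coin_group_disjoint:
  assumes "\<And>x. x \<in> I \<Longrightarrow> x \<inter> \<tau> = {}"
  shows "disjoint_family_on (coin_group \<tau>) I"
proof -
  have "\<beta> - \<tau> = x" if "\<beta> \<in> coin_group \<tau> x" "x \<in> I" for \<beta> x
    using that assms[of x] by (auto simp: coin_group_def)
  then show ?thesis unfolding disjoint_family_on_def by (metis disjoint_iff)
qed

text \<open>Split a nonempty \<open>\<beta>\<close> into \<open>\<beta> \<inter> x\<close> and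
  \<open>\<beta> \<inter> \<tau>\<close>; its coin lies in the group of
  \<open>\<beta> \<inter> x\<close>. With \<open>x\<close> a vertex or a pair outside
  \<open>\<tau>\<close>, this describes the link graph by independent events. For empty
  \<open>\<tau>\<close> the group of \<open>{}\<close> is empty, hence always heads, so
  \<open>k = 0\<close> needs no separate treatment.\<close>

lemma Un_mem_coin_complex_iff:
  assumes "\<tau> \<subseteq> {..<n}" "x \<subseteq> {..<n}"
  shows "x \<union> \<tau> \<in> coin_complex n c
    \<longleftrightarrow> x \<union> \<tau> \<noteq> {} \<and> (\<forall>y\<subseteq>x. heads c (coin_group \<tau> y))"
proof -
  have "(\<forall>\<beta>\<subseteq>x \<union> \<tau>. \<beta> \<noteq> {} \<longrightarrow> c \<beta>) \<longleftrightarrow> (\<forall>y\<subseteq>x. \<forall>\<alpha>\<subseteq>\<tau>. y \<union> \<alpha> \<noteq> {} \<longrightarrow> c (y \<union> \<alpha>))"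
  proof (intro iffI allI impI)
    fix \<beta> assume *: "\<forall>y\<subseteq>x. \<forall>\<alpha>\<subseteq>\<tau>. y \<union> \<alpha> \<noteq> {} \<longrightarrow> c (y \<union> \<alpha>)"
      and \<beta>: "\<beta> \<subseteq> x \<union> \<tau>" "\<beta> \<noteq> {}"
    have "\<beta> = (\<beta> \<inter> x) \<union> (\<beta> \<inter> \<tau>)" using \<beta> by blast
    then show "c \<beta>" using *[rule_format, of "\<beta> \<inter> x" "\<beta> \<inter> \<tau>"] \<beta> by auto
  next
    fix y \<alpha>
    assume "\<forall>\<beta>\<subseteq>x \<union> \<tau>. \<beta> \<noteq> {} \<longrightarrow> c \<beta>" "y \<subseteq> x" "\<alpha> \<subseteq> \<tau>" "y \<union> \<alpha> \<noteq> {}"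
    then show "c (y \<union> \<alpha>)" by (meson Un_mono)
  qed
  moreover have "heads c (coin_group \<tau> y) \<longleftrightarrow> (\<forall>\<alpha>\<subseteq>\<tau>. y \<union> \<alpha> \<noteq> {} \<longrightarrow> c (y \<union> \<alpha>))" for y
    by (auto simp: heads_def coin_group_def)
  moreover have "x \<union> \<tau> \<in> nonempty_faces n \<longleftrightarrow> x \<union> \<tau> \<noteq> {}"
    using assms by (auto simp: nonempty_faces_def)
  ultimately show ?thesis by (simp only: coin_complex_def mem_Collect_eq)
qed

section \<open>Probabilities of faces and of their links\<close>

text \<open>The probability that the group of a set \<open>x\<close> of \<open>a + 1\<close>
  vertices outside \<open>\<tau>\<close> shows only heads, as \<open>x \<union> \<alpha>\<close> has
  dimension \<open>card \<alpha> + a\<close>. Thus \<open>a = 0\<close> belongs to a vertex of the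
  link, and \<open>a = 1\<close> to an edge of the link given its ends.\<close>

definition link_prob :: "(nat \<Rightarrow> real) \<Rightarrow> nat \<Rightarrow> nat set \<Rightarrow> real" where
  "link_prob p a \<tau> = (\<Prod>\<alpha>\<in>Pow \<tau>. p (card \<alpha> + a))"

definition face_prob :: "(nat \<Rightarrow> real) \<Rightarrow> nat set \<Rightarrow> real" where
  "face_prob p \<tau> = (\<Prod>\<alpha>\<in>Pow \<tau> - {{}}. p (card \<alpha> - 1))"

text \<open>A subset of \<open>insert v \<tau>\<close> avoids \<open>v\<close> or is
  \<open>insert v \<alpha>\<close> with \<open>\<alpha> \<subseteq> \<tau>\<close>, and the extra
  vertex raises \<open>a\<close> by one. At \<open>a = 0\<close> this splits \<open>rr p k\<close>
  into the probabilities of a vertex and of an edge in the link of a set with \<open>k\<close>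
  elements.\<close>

lemma link_prob_insert:
  assumes "finite \<tau>" "v \<notin> \<tau>"
  shows "link_prob p a (insert v \<tau>) = link_prob p a \<tau> * link_prob p (Suc a) \<tau>"
proof -
  have inj: "inj_on (insert v) (Pow \<tau>)" using assms(2) by (auto simp: inj_on_def)
  have "link_prob p a (insert v \<tau>)
      = link_prob p a \<tau> * (\<Prod>\<alpha>\<in>insert v ` Pow \<tau>. p (card \<alpha> + a))"
    unfolding link_prob_def Pow_insert using assms by (intro prod.union_disjoint) auto
  also have "(\<Prod>\<alpha>\<in>insert v ` Pow \<tau>. p (card \<alpha> + a)) = link_prob p (Suc a) \<tau>"
    unfolding prod.reindex[OF inj] link_prob_def using assms
    by (intro prod.cong refl) (auto simp: card_insert_if finite_subset o_def)
  finally show ?thesis .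
qed

lemma face_prob_insert:
  assumes "finite \<tau>" "v \<notin> \<tau>"
  shows "face_prob p (insert v \<tau>) = face_prob p \<tau> * link_prob p 0 \<tau>"
proof -
  have inj: "inj_on (insert v) (Pow \<tau>)" using assms(2) by (auto simp: inj_on_def)
  have "Pow (insert v \<tau>) - {{}} = (Pow \<tau> - {{}}) \<union> insert v ` Pow \<tau>"
    by (auto simp: Pow_insert)
  then have "face_prob p (insert v \<tau>)
      = face_prob p \<tau> * (\<Prod>\<alpha>\<in>insert v ` Pow \<tau>. p (card \<alpha> - 1))"
    unfolding face_prob_def using assms by (simp only:) (intro prod.union_disjoint, auto)
  also have "(\<Prod>\<alpha>\<in>insert v ` Pow \<tau>. p (card \<alpha> - 1)) = link_prob p 0 \<tau>"
    unfolding prod.reindex[OF inj] link_prob_def using assms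
    by (intro prod.cong refl) (auto simp: card_insert_if finite_subset o_def)
  finally show ?thesis .
qed

lemma prod_Pow_card:
  assumes "finite A"
  shows "(\<Prod>\<alpha>\<in>Pow A. f (card \<alpha>) :: real) = (\<Prod>i\<le>card A. f i ^ (card A choose i))"
proof -
  have "(\<Prod>\<alpha>\<in>Pow A. f (card \<alpha>)) = (\<Prod>i\<le>card A. \<Prod>\<alpha> | \<alpha> \<in> Pow A \<and> card \<alpha> = i. f (card \<alpha>))"
    using assms by (intro prod.group[symmetric]) (auto intro: card_mono)
  also have "\<dots> = (\<Prod>i\<le>card A. f i ^ (card A choose i))"
    using assms by (intro prod.cong refl) (simp add: n_subsets)
  finally show ?thesis .
qed

lemma link_prob_eq_rr:
  assumes "finite \<sigma>" "card \<sigma> = k + 1"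
  shows "link_prob p 0 \<sigma> = rr p k"
  unfolding rr_eq_prod link_prob_def using prod_Pow_card[OF assms(1), of p] assms(2) by simp

lemma face_prob_eq_qq:
  assumes "finite \<sigma>" "card \<sigma> = k + 1"
  shows "face_prob p \<sigma> = qq p k"
proof -
  have "face_prob p \<sigma> = (\<Prod>\<alpha>\<in>Pow \<sigma>. if card \<alpha> = 0 then 1 else p (card \<alpha> - 1))"
    unfolding face_prob_def using assms
    by (intro prod.mono_neutral_cong_left) (auto dest: finite_subset)
  also have "\<dots> = (\<Prod>i\<le>Suc k. (if i = 0 then 1 else p (i - 1)) ^ (Suc k choose i))"
    using prod_Pow_card[OF assms(1), of "\<lambda>i. if i = 0 then 1 else p (i - 1)"] assms(2) by simp
  also have "\<dots> = qq p k"
    unfolding prod.atMost_Suc_shift qq_def by simp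
  finally show ?thesis .
qed

lemma group_prob_empty: "group_prob p (coin_group \<tau> {}) = face_prob p \<tau>"
  by (simp add: group_prob_def coin_group_def face_prob_def)

lemma group_prob_link:
  assumes "finite \<tau>" "x \<inter> \<tau> = {}" "card x = Suc a"
  shows "group_prob p (coin_group \<tau> x) = link_prob p a \<tau>"
proof -
  have fx: "finite x" "x \<noteq> {}" using assms(3) by (auto intro: card_ge_0_finite)
  have inj: "inj_on (\<lambda>\<alpha>. x \<union> \<alpha>) (Pow \<tau>)" using assms(2) by (auto simp: inj_on_def)
  have "coin_group \<tau> x = (\<lambda>\<alpha>. x \<union> \<alpha>) ` Pow \<tau>" using fx by (auto simp: coin_group_def)
  then have "group_prob p (coin_group \<tau> x) = (\<Prod>\<alpha>\<in>Pow \<tau>. p (card (x \<union> \<alpha>) - 1))"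
    by (simp add: group_prob_def prod.reindex[OF inj])
  also have "\<dots> = link_prob p a \<tau>"
    unfolding link_prob_def
  proof (intro prod.cong refl)
    fix \<alpha> assume "\<alpha> \<in> Pow \<tau>"
    then have "card (x \<union> \<alpha>) = Suc a + card \<alpha>"
      using assms fx by (subst card_Un_disjoint) (auto intro: finite_subset)
    then show "p (card (x \<union> \<alpha>) - 1) = p (card \<alpha> + a)" by (simp add: add.commute)
  qed
  finally show ?thesis .
qed

section \<open>Garland's identity\<close>

definition face_sign :: "nat set \<Rightarrow> nat \<Rightarrow> real" where
  "face_sign \<sigma> v = (-1) ^ card {w \<in> \<sigma>. w < v}"

lemma face_sign_square [simp]: "face_sign \<sigma> v * face_sign \<sigma> v = 1"
  by (simp add: face_sign_def flip: power_mult_distrib)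

text \<open>Removing the smaller vertex shifts the position of the larger one by one, while removing
  the larger one shifts nothing. This is the sign rule behind \<open>boundary_boundary\<close>,
  arranged so that the right-hand side carries the signs of the two localizations at
  \<open>\<sigma> - {u, v}\<close>.\<close>

lemma face_sign_swap:
  assumes "finite \<sigma>" "u \<in> \<sigma>" "v \<in> \<sigma>" "u \<noteq> v"
  shows "face_sign \<sigma> v * face_sign \<sigma> u = - (face_sign (\<sigma> - {v}) u * face_sign (\<sigma> - {u}) v)"
proof -
  have *: "face_sign \<sigma> b * face_sign \<sigma> a = - (face_sign (\<sigma> - {b}) a * face_sign (\<sigma> - {a}) b)"
    if "a < b" "a \<in> \<sigma>" "b \<in> \<sigma>" for a b
  proof -
    have "{w \<in> \<sigma>. w < b} = insert a {w \<in> \<sigma> - {a}. w < b}" using that by auto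
    then have "face_sign \<sigma> b = - face_sign (\<sigma> - {a}) b"
      using assms(1) by (simp add: face_sign_def)
    moreover have "{w \<in> \<sigma> - {b}. w < a} = {w \<in> \<sigma>. w < a}" using that by auto
    then have "face_sign (\<sigma> - {b}) a = face_sign \<sigma> a" by (simp add: face_sign_def)
    ultimately show ?thesis by simp
  qed
  show ?thesis
  proof (cases "u < v")
    case True
    then show ?thesis by (rule *) fact+
  next
    case False
    then have "v < u" using assms(4) by simp
    from *[OF this assms(3,2)] show ?thesis
      by (simp only: mult.commute)
  qed
qed

lemma lookup_simplex_boundary:
  "Poly_Mapping.lookup (simplex_boundary \<sigma>) \<tau>
    = (\<Sum>v\<in>\<sigma>. if \<sigma> - {v} = \<tau> then face_sign \<sigma> v else 0)"
  unfolding face_sign_def by (simp add: simplex_boundary_def lookup_sum lookup_single when_def)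

text \<open>The cochain induced on the vertices of the link of \<open>\<tau>\<close>.\<close>

definition localize :: "(nat set \<Rightarrow> real) \<Rightarrow> nat set \<Rightarrow> nat \<Rightarrow> real" where
  "localize f \<tau> u = face_sign (insert u \<tau>) u * f (insert u \<tau>)"

text \<open>The sum is the coefficient of \<open>boundary c\<close> at \<open>\<tau>\<close>. It is
  what permits the centring of the link matrix. For \<open>k = 0\<close> and empty
  \<open>\<tau>\<close> it is the augmentation, so here reduced homology is essential.\<close>

lemma cycle_localize_sum:
  assumes c: "c \<in> cycles K (int k)" and K: "K \<subseteq> nonempty_faces n"
    and \<tau>: "\<tau> \<subseteq> {..<n}" "card \<tau> = k"
  shows "(\<Sum>u\<in>{..<n} - \<tau>. localize (Poly_Mapping.lookup c) \<tau> u) = 0"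
proof -
  let ?f = "Poly_Mapping.lookup c" and ?F = "{\<sigma> \<in> Pow {..<n}. card \<sigma> = k + 1}"
  have keys: "Poly_Mapping.keys c \<subseteq> ?F"
    using c K by (fastforce simp: cycles_def chains_def nonempty_faces_def)
  have "0 = Poly_Mapping.lookup (boundary c) \<tau>"
    using c by (simp add: cycles_def)
  also have "\<dots> = (\<Sum>\<sigma>\<in>?F. ?f \<sigma> * (\<Sum>v\<in>\<sigma>. if \<sigma> - {v} = \<tau> then face_sign \<sigma> v else 0))"
    by (subst boundary_eq_sum[OF _ keys])
      (auto simp: lookup_sum lookup_scaleR lookup_simplex_boundary)
  also have "\<dots> = (\<Sum>\<sigma>\<in>?F. \<Sum>v | v \<in> \<sigma> \<and> \<sigma> - {v} = \<tau>. face_sign \<sigma> v * ?f \<sigma>)"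
  proof (intro sum.cong refl)
    fix \<sigma> assume "\<sigma> \<in> ?F"
    then have "finite \<sigma>" by (auto intro: finite_subset)
    then show "?f \<sigma> * (\<Sum>v\<in>\<sigma>. if \<sigma> - {v} = \<tau> then face_sign \<sigma> v else 0)
        = (\<Sum>v | v \<in> \<sigma> \<and> \<sigma> - {v} = \<tau>. face_sign \<sigma> v * ?f \<sigma>)"
      by (simp add: sum.inter_filter[symmetric] sum_distrib_left mult.commute)
  qed
  also have "\<dots> = (\<Sum>(\<sigma>, v)\<in>(SIGMA \<sigma>:?F. {v. v \<in> \<sigma> \<and> \<sigma> - {v} = \<tau>}). face_sign \<sigma> v * ?f \<sigma>)"
    by (intro sum.Sigma) (auto intro: finite_subset)
  also have "\<dots> = (\<Sum>u\<in>{..<n} - \<tau>. localize ?f \<tau> u)"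
  proof (rule sum.reindex_bij_witness[where i = "\<lambda>u. (insert u \<tau>, u)" and j = snd])
    fix q assume "q \<in> (SIGMA \<sigma>:?F. {v. v \<in> \<sigma> \<and> \<sigma> - {v} = \<tau>})"
    then obtain v where q: "q = (insert v \<tau>, v)" "v \<in> {..<n} - \<tau>" by auto
    show "(insert (snd q) \<tau>, snd q) = q" "snd q \<in> {..<n} - \<tau>" using q by auto
    show "localize ?f \<tau> (snd q) = (case q of (\<sigma>, v) \<Rightarrow> face_sign \<sigma> v * ?f \<sigma>)"
      using q by (simp add: localize_def)
  next
    fix u assume u: "u \<in> {..<n} - \<tau>"
    have "finite \<tau>" using \<tau>(1) finite_subset by blast
    then show "(insert u \<tau>, u) \<in> (SIGMA \<sigma>:?F. {v. v \<in> \<sigma> \<and> \<sigma> - {v} = \<tau>})"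
      using u \<tau> by auto
  qed simp
  finally show ?thesis by simp
qed

text \<open>Orthogonality is tested on the boundary of the single simplex \<open>\<rho>\<close>; the
  pairing is the value at \<open>\<rho>\<close> of the coboundary of \<open>t\<close>.\<close>

lemma cocycle_condition:
  assumes orth: "\<forall>b\<in>boundaries K (int k).
      chain_inner {\<sigma> \<in> K. finite \<sigma> \<and> card \<sigma> = k + 1} t b = 0"
    and closed: "\<And>\<sigma> \<tau>. \<sigma> \<in> K \<Longrightarrow> \<tau> \<subseteq> \<sigma> \<Longrightarrow> \<tau> \<noteq> {} \<Longrightarrow> \<tau> \<in> K" and K: "finite K"
    and \<rho>: "\<rho> \<in> K" "card \<rho> = k + 2"
  shows "(\<Sum>v\<in>\<rho>. face_sign \<rho> v * Poly_Mapping.lookup t (\<rho> - {v})) = 0"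
proof -
  let ?F = "{\<sigma> \<in> K. finite \<sigma> \<and> card \<sigma> = k + 1}" and ?f = "Poly_Mapping.lookup t"
  have fin: "finite \<rho>" using \<rho>(2) by (auto intro: card_ge_0_finite)
  have face: "\<rho> - {v} \<in> ?F" if "v \<in> \<rho>" for v
  proof -
    have "card (\<rho> - {v}) = k + 1" using fin that \<rho>(2) by simp
    moreover from this have "\<rho> - {v} \<noteq> {}" by (metis add_is_0 card.empty one_neq_zero)
    ultimately show ?thesis using closed[OF \<rho>(1), of "\<rho> - {v}"] fin by auto
  qed
  have "Poly_Mapping.single \<rho> 1 \<in> chains K (int k + 1)"
    using \<rho> fin by (simp add: chains_def)
  then have "boundary (Poly_Mapping.single \<rho> 1) \<in> boundaries K (int k)"
    unfolding boundaries_def by blast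
  then have "0 = chain_inner ?F t (simplex_boundary \<rho>)"
    using orth by (simp add: boundary_single)
  also have "\<dots> = (\<Sum>\<sigma>\<in>?F. \<Sum>v\<in>\<rho>. if \<sigma> = \<rho> - {v} then face_sign \<rho> v * ?f \<sigma> else 0)"
    unfolding chain_inner_def lookup_simplex_boundary sum_distrib_left
    by (intro sum.cong refl) auto
  also have "\<dots> = (\<Sum>v\<in>\<rho>. \<Sum>\<sigma>\<in>?F. if \<sigma> = \<rho> - {v} then face_sign \<rho> v * ?f \<sigma> else 0)"
    by (rule sum.swap)
  also have "\<dots> = (\<Sum>v\<in>\<rho>. face_sign \<rho> v * ?f (\<rho> - {v}))"
  proof (intro sum.cong refl)
    fix v assume v: "v \<in> \<rho>"
    have "finite ?F" using K by simp
    from sum.delta[OF this, of "\<rho> - {v}" "\<lambda>\<sigma>. face_sign \<rho> v * ?f \<sigma>"]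
    show "(\<Sum>\<sigma>\<in>?F. if \<sigma> = \<rho> - {v} then face_sign \<rho> v * ?f \<sigma> else 0)
        = face_sign \<rho> v * ?f (\<rho> - {v})"
      using face[OF v] by simp
  qed
  finally show ?thesis by simp
qed

definition face_degree :: "nat \<Rightarrow> nat set set \<Rightarrow> nat set \<Rightarrow> nat" where
  "face_degree n K \<sigma> = card {v \<in> {..<n} - \<sigma>. insert v \<sigma> \<in> K}"

text \<open>Square the vanishing coboundary at every \<open>\<rho>\<close> and sum. The diagonal
  terms meet each \<open>\<sigma>\<close> once per coface, which gives the degrees. An off-diagonal
  term for \<open>u\<close> and \<open>v\<close> is attributed to
  \<open>\<tau> = \<rho> - {u, v}\<close>, where \<open>face_sign_swap\<close> makes it minus a
  product of localizations. Only the cocycle condition enters.\<close>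

lemma garland_identity:
  fixes f :: "nat set \<Rightarrow> real"
  assumes K: "K \<subseteq> nonempty_faces n"
    and closed: "\<And>\<sigma> \<tau>. \<sigma> \<in> K \<Longrightarrow> \<tau> \<subseteq> \<sigma> \<Longrightarrow> \<tau> \<noteq> {} \<Longrightarrow> \<tau> \<in> K"
    and cocycle: "\<And>\<rho>. \<rho> \<in> K \<Longrightarrow> card \<rho> = k + 2 \<Longrightarrow> (\<Sum>v\<in>\<rho>. face_sign \<rho> v * f (\<rho> - {v})) = 0"
  shows "(\<Sum>\<sigma> | \<sigma> \<in> K \<and> card \<sigma> = k + 1. real (face_degree n K \<sigma>) * (f \<sigma>)\<^sup>2)
    = (\<Sum>\<tau> | \<tau> \<subseteq> {..<n} \<and> card \<tau> = k. \<Sum>u\<in>{..<n} - \<tau>. \<Sum>v\<in>{..<n} - \<tau>.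
        of_bool (u \<noteq> v \<and> insert u (insert v \<tau>) \<in> K) * localize f \<tau> u * localize f \<tau> v)"
proof -
  define R where "R = {\<rho> \<in> K. card \<rho> = k + 2}"
  define F where "F = {\<sigma> \<in> K. card \<sigma> = k + 1}"
  define T where "T = {\<tau>. \<tau> \<subseteq> {..<n} \<and> card \<tau> = k}"
  define a where "a \<rho> v = face_sign \<rho> v * f (\<rho> - {v})" for \<rho> v
  have finK: "finite K" using K by (rule finite_subset) simp
  then have finR: "finite R" "finite F" by (simp_all add: R_def F_def)
  have finT: "finite T" by (simp add: T_def)
  have Kfin: "finite \<sigma>" "\<sigma> \<subseteq> {..<n}" if "\<sigma> \<in> K" for \<sigma>
    using that K nonempty_facesD(1)[of \<sigma> n] by (auto simp: nonempty_faces_def)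
  have split: "(\<Sum>v\<in>\<rho>. a \<rho> v)\<^sup>2 = (\<Sum>v\<in>\<rho>. (a \<rho> v)\<^sup>2) + (\<Sum>v\<in>\<rho>. \<Sum>u\<in>\<rho> - {v}. a \<rho> v * a \<rho> u)"
    if "finite \<rho>" for \<rho>
    unfolding power2_eq_square sum_product sum.distrib[symmetric]
    using that by (intro sum.cong refl) (simp add: sum.remove)
  have "0 = (\<Sum>\<rho>\<in>R. (\<Sum>v\<in>\<rho>. a \<rho> v)\<^sup>2)"
    using cocycle by (simp add: R_def a_def)
  also have "\<dots> = (\<Sum>\<rho>\<in>R. \<Sum>v\<in>\<rho>. (a \<rho> v)\<^sup>2) + (\<Sum>\<rho>\<in>R. \<Sum>v\<in>\<rho>. \<Sum>u\<in>\<rho> - {v}. a \<rho> v * a \<rho> u)"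
    by (subst sum.distrib[symmetric], intro sum.cong refl split) (auto simp: R_def Kfin)
  also have "(\<Sum>\<rho>\<in>R. \<Sum>v\<in>\<rho>. (a \<rho> v)\<^sup>2) = (\<Sum>\<sigma>\<in>F. real (face_degree n K \<sigma>) * (f \<sigma>)\<^sup>2)"
  proof -
    have "(\<Sum>\<rho>\<in>R. \<Sum>v\<in>\<rho>. (a \<rho> v)\<^sup>2) = (\<Sum>(\<rho>, v)\<in>(SIGMA \<rho>:R. \<rho>). (f (\<rho> - {v}))\<^sup>2)"
      using finR by (subst sum.Sigma) (auto simp: a_def power2_eq_square R_def Kfin
        face_sign_def power_mult_distrib[symmetric] mult_ac intro!: sum.cong)
    also have "\<dots> = (\<Sum>(\<sigma>, v)\<in>(SIGMA \<sigma>:F. {v \<in> {..<n} - \<sigma>. insert v \<sigma> \<in> K}). (f \<sigma>)\<^sup>2)"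
    proof (rule sum.reindex_bij_witness[where i = "\<lambda>(\<sigma>, v). (insert v \<sigma>, v)"
          and j = "\<lambda>(\<rho>, v). (\<rho> - {v}, v)"])
      fix q assume "q \<in> (SIGMA \<rho>:R. \<rho>)"
      then obtain \<rho> v where q: "q = (\<rho>, v)" "\<rho> \<in> K" "card \<rho> = k + 2" "v \<in> \<rho>"
        by (auto simp: R_def)
      have c: "card (\<rho> - {v}) = k + 1" using q Kfin(1)[of \<rho>] by simp
      then have "\<rho> - {v} \<noteq> {}" by (metis add_is_0 card.empty one_neq_zero)
      then have "\<rho> - {v} \<in> F" using closed[of \<rho> "\<rho> - {v}"] q c by (auto simp: F_def)
      then show "(\<lambda>(\<rho>, v). (\<rho> - {v}, v)) q \<in> (SIGMA \<sigma>:F. {v \<in> {..<n} - \<sigma>. insert v \<sigma> \<in> K})"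
        using q Kfin(2)[of \<rho>] by (auto simp: insert_absorb)
    next
      fix q assume "q \<in> (SIGMA \<sigma>:F. {v \<in> {..<n} - \<sigma>. insert v \<sigma> \<in> K})"
      then show "(\<lambda>(\<sigma>, v). (insert v \<sigma>, v)) q \<in> (SIGMA \<rho>:R. \<rho>)"
        by (auto simp: F_def R_def Kfin)
    qed (auto simp: insert_absorb)
    also have "\<dots> = (\<Sum>\<sigma>\<in>F. \<Sum>v | v \<in> {..<n} - \<sigma> \<and> insert v \<sigma> \<in> K. (f \<sigma>)\<^sup>2)"
      using finR by (intro sum.Sigma[symmetric]) auto
    finally show ?thesis by (simp add: face_degree_def)
  qed
  also have "(\<Sum>\<rho>\<in>R. \<Sum>v\<in>\<rho>. \<Sum>u\<in>\<rho> - {v}. a \<rho> v * a \<rho> u)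
      = - (\<Sum>\<tau>\<in>T. \<Sum>u\<in>{..<n} - \<tau>. \<Sum>v\<in>{..<n} - \<tau>.
        of_bool (u \<noteq> v \<and> insert u (insert v \<tau>) \<in> K) * localize f \<tau> u * localize f \<tau> v)"
  proof -
    define P where "P = (SIGMA \<rho>:R. SIGMA v:\<rho>. \<rho> - {v})"
    define Q where "Q = (SIGMA \<tau>:T. SIGMA u:{..<n} - \<tau>.
      {v \<in> {..<n} - \<tau>. u \<noteq> v \<and> insert u (insert v \<tau>) \<in> K})"
    have "(\<Sum>\<rho>\<in>R. \<Sum>v\<in>\<rho>. \<Sum>u\<in>\<rho> - {v}. a \<rho> v * a \<rho> u) = (\<Sum>(\<rho>, v, u)\<in>P. a \<rho> v * a \<rho> u)"
      using finR Kfin by (simp add: P_def R_def sum.Sigma)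
    also have "\<dots> = (\<Sum>(\<tau>, u, v)\<in>Q. - (localize f \<tau> u * localize f \<tau> v))"
    proof (rule sum.reindex_bij_witness[where i = "\<lambda>(\<tau>, u, v). (insert u (insert v \<tau>), v, u)"
          and j = "\<lambda>(\<rho>, v, u). (\<rho> - {u, v}, u, v)"])
      fix q assume "q \<in> P"
      then obtain \<rho> v u where q: "q = (\<rho>, v, u)" "\<rho> \<in> K" "card \<rho> = k + 2" "v \<in> \<rho>" "u \<in> \<rho>" "u \<noteq> v"
        by (auto simp: R_def P_def)
      note fin = Kfin(1)[OF q(2)]
      have ins: "insert u (insert v (\<rho> - {u, v})) = \<rho>" "insert v (insert u (\<rho> - {u, v})) = \<rho>"
        "insert u (\<rho> - {u, v}) = \<rho> - {v}" "insert v (\<rho> - {u, v}) = \<rho> - {u}"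
        using q by auto
      show "(\<lambda>(\<tau>, u, v). (insert u (insert v \<tau>), v, u)) ((\<lambda>(\<rho>, v, u). (\<rho> - {u, v}, u, v)) q) = q"
        by (simp only: q(1) prod.case ins(1))
      have "card (\<rho> - {u, v}) = k" using q fin by (simp add: card_Diff_subset)
      moreover have "\<rho> - {u, v} \<subseteq> {..<n}" "u < n" "v < n" using q Kfin(2)[OF q(2)] by auto
      moreover have "insert u (insert v (\<rho> - {u, v})) \<in> K" unfolding ins(1) by (rule q)
      ultimately show "(\<lambda>(\<rho>, v, u). (\<rho> - {u, v}, u, v)) q \<in> Q"
        unfolding Q_def T_def q(1) prod.case using q(6) by blast
      have "a \<rho> v * a \<rho> u = face_sign \<rho> v * face_sign \<rho> u * (f (\<rho> - {v}) * f (\<rho> - {u}))"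
        by (simp add: a_def)
      also have "\<dots> = - (localize f (\<rho> - {u, v}) u * localize f (\<rho> - {u, v}) v)"
        unfolding face_sign_swap[OF fin q(5,4,6)] by (simp add: localize_def ins)
      finally show "(case (\<lambda>(\<rho>, v, u). (\<rho> - {u, v}, u, v)) q of
          (\<tau>, u, v) \<Rightarrow> - (localize f \<tau> u * localize f \<tau> v))
        = (case q of (\<rho>, v, u) \<Rightarrow> a \<rho> v * a \<rho> u)"
        by (simp only: q(1) prod.case)
    next
      fix q assume "q \<in> Q"
      then obtain \<tau> u v where q: "q = (\<tau>, u, v)" "\<tau> \<subseteq> {..<n}" "card \<tau> = k" "u < n" "v < n"
        "u \<notin> \<tau>" "v \<notin> \<tau>" "u \<noteq> v" "insert u (insert v \<tau>) \<in> K"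
        by (auto simp: Q_def T_def)
      have "finite \<tau>" using q(2) finite_subset by blast
      then have "card (insert u (insert v \<tau>)) = k + 2" using q by simp
      then show "(\<lambda>(\<tau>, u, v). (insert u (insert v \<tau>), v, u)) q \<in> P"
        using q by (auto simp: P_def R_def)
      show "(\<lambda>(\<rho>, v, u). (\<rho> - {u, v}, u, v)) ((\<lambda>(\<tau>, u, v). (insert u (insert v \<tau>), v, u)) q) = q"
        using q by auto
    qed
    also have "\<dots> = - (\<Sum>(\<tau>, u, v)\<in>Q. localize f \<tau> u * localize f \<tau> v)"
      by (simp add: case_prod_unfold sum_negf)
    also have "(\<Sum>(\<tau>, u, v)\<in>Q. localize f \<tau> u * localize f \<tau> v)
      = (\<Sum>\<tau>\<in>T. \<Sum>u\<in>{..<n} - \<tau>. \<Sum>v | v \<in> {..<n} - \<tau> \<and> u \<noteq> v \<and> insert u (insert v \<tau>) \<in> K.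
          localize f \<tau> u * localize f \<tau> v)"
      using finT by (simp add: Q_def sum.Sigma)
    also have "\<dots> = (\<Sum>\<tau>\<in>T. \<Sum>u\<in>{..<n} - \<tau>. \<Sum>v\<in>{..<n} - \<tau>.
        of_bool (u \<noteq> v \<and> insert u (insert v \<tau>) \<in> K) * localize f \<tau> u * localize f \<tau> v)"
      by (rule sum.cong[OF refl], rule sum.cong[OF refl], subst sum.inter_filter)
        (auto intro!: sum.cong)
    finally show ?thesis .
  qed
  finally show ?thesis by (simp add: R_def F_def T_def)
qed

section \<open>A local bound on the Betti numbers\<close>

text \<open>Extend \<open>g\<close> by zero from the image of \<open>h\<close> to \<open>F\<close>.
  In the application \<open>h\<close> sends a link vertex \<open>w\<close> to the face
  \<open>insert w \<tau>\<close>, so a row of a link matrix becomes a vector on faces.\<close>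

lemma bessel_reindex:
  assumes T: "orthonormal F T" and F: "finite F" and h: "inj_on h W" "h ` W \<subseteq> F"
  shows "(\<Sum>t\<in>T. (\<Sum>w\<in>W. Poly_Mapping.lookup t (h w) * g w)\<^sup>2) \<le> (\<Sum>w\<in>W. (g w)\<^sup>2)"
proof -
  define G where "G \<sigma> = (if \<sigma> \<in> h ` W then g (inv_into W h \<sigma>) else 0)" for \<sigma>
  have Gh: "G (h w) = g w" if "w \<in> W" for w
    using that h(1) by (simp add: G_def)
  have G0: "G \<sigma> = 0" if "\<sigma> \<notin> h ` W" for \<sigma> using that by (simp add: G_def)
  have reindex: "(\<Sum>\<sigma>\<in>F. x \<sigma>) = (\<Sum>w\<in>W. x (h w))" if "\<And>\<sigma>. \<sigma> \<in> F - h ` W \<Longrightarrow> x \<sigma> = 0"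
    for x :: "nat set \<Rightarrow> real"
  proof -
    have "(\<Sum>\<sigma>\<in>F. x \<sigma>) = (\<Sum>\<sigma>\<in>h ` W. x \<sigma>)"
      using F h(2) that by (intro sum.mono_neutral_right) auto
    then show ?thesis by (simp add: sum.reindex[OF h(1)])
  qed
  have "(\<Sum>\<sigma>\<in>F. Poly_Mapping.lookup t \<sigma> * G \<sigma>) = (\<Sum>w\<in>W. Poly_Mapping.lookup t (h w) * g w)" for t
    by (subst reindex) (auto simp: Gh G0)
  moreover have "(\<Sum>\<sigma>\<in>F. (G \<sigma>)\<^sup>2) = (\<Sum>w\<in>W. (g w)\<^sup>2)"
    by (subst reindex) (auto simp: Gh G0)
  ultimately show ?thesis using bessel[OF T F, of G] by simp
qed

text \<open>The adjacency matrix of the link graph of \<open>\<tau>\<close>, centred so that its entries have mean 0 when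
  \<open>s\<close> is the conditional probability of an edge.\<close>

definition link_matrix :: "nat set set \<Rightarrow> real \<Rightarrow> nat set \<Rightarrow> nat \<Rightarrow> nat \<Rightarrow> real" where
  "link_matrix K s \<tau> u v = (if u \<noteq> v \<and> insert u \<tau> \<in> K \<and> insert v \<tau> \<in> K
     then of_bool (insert u (insert v \<tau>) \<in> K) - s else 0)"

lemma link_matrix_sym: "link_matrix K s \<tau> u v = link_matrix K s \<tau> v u"
  by (auto simp: link_matrix_def insert_commute)

text \<open>Subtracting \<open>s\<close> off the diagonal changes the quadratic form by
  \<open>s\<close> times the sum of the squares of \<open>x\<close>, minus \<open>s\<close> times
  the square of the sum. The latter vanishes and the former is nonnegative. The diagonal itself is
  left at 0 so that walks with loops have weight 0.\<close>

lemma sum_adjacent_le_link_matrix: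
  assumes closed: "\<And>\<sigma> \<tau>. \<sigma> \<in> K \<Longrightarrow> \<tau> \<subseteq> \<sigma> \<Longrightarrow> \<tau> \<noteq> {} \<Longrightarrow> \<tau> \<in> K" and N: "finite N"
    and supp: "\<And>u. u \<in> N \<Longrightarrow> insert u \<tau> \<notin> K \<Longrightarrow> x u = 0"
    and zero: "(\<Sum>u\<in>N. x u) = 0" and "0 \<le> s"
  shows "(\<Sum>u\<in>N. \<Sum>v\<in>N. of_bool (u \<noteq> v \<and> insert u (insert v \<tau>) \<in> K) * x u * x v)
    \<le> inner_on N x (apply_mat N (link_matrix K s \<tau>) x)"
proof -
  have "inner_on N x (apply_mat N (link_matrix K s \<tau>) x)
      = (\<Sum>u\<in>N. \<Sum>v\<in>N. link_matrix K s \<tau> u v * (x u * x v))"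
    by (simp add: inner_on_def apply_mat_def sum_distrib_left ac_simps)
  also have "\<dots> = (\<Sum>u\<in>N. \<Sum>v\<in>N. of_bool (u \<noteq> v \<and> insert u (insert v \<tau>) \<in> K) * x u * x v
      - (s * (x u * x v) - (if v = u then s * (x u * x v) else 0)))"
    using supp by (intro sum.cong refl) (auto simp: link_matrix_def algebra_simps)
  also have "\<dots> = (\<Sum>u\<in>N. \<Sum>v\<in>N. of_bool (u \<noteq> v \<and> insert u (insert v \<tau>) \<in> K) * x u * x v)
      - (s * (\<Sum>u\<in>N. x u) * (\<Sum>v\<in>N. x v) - (\<Sum>u\<in>N. s * (x u * x u)))"
    using N by (simp add: sum_subtractf sum_distrib_left sum_distrib_right ac_simps)
  finally have eq: "inner_on N x (apply_mat N (link_matrix K s \<tau>) x)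
      = (\<Sum>u\<in>N. \<Sum>v\<in>N. of_bool (u \<noteq> v \<and> insert u (insert v \<tau>) \<in> K) * x u * x v)
        + (\<Sum>u\<in>N. s * (x u * x u))"
    by (simp add: zero)
  have "0 \<le> (\<Sum>u\<in>N. s * (x u * x u))" using \<open>0 \<le> s\<close> by (intro sum_nonneg) simp
  with eq show ?thesis by simp
qed

text \<open>Each face is reached once from each of its \<open>k + 1\<close> vertices, and the signs
  square away.\<close>

lemma sum_localize_squares:
  assumes supp: "\<And>\<sigma>. f \<sigma> \<noteq> 0 \<Longrightarrow> \<sigma> \<subseteq> {..<n} \<and> card \<sigma> = k + 1"
  shows "(\<Sum>\<tau> | \<tau> \<subseteq> {..<n} \<and> card \<tau> = k. inner_on ({..<n} - \<tau>) (localize f \<tau>) (localize f \<tau>))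
    = real (k + 1) * (\<Sum>\<sigma> | \<sigma> \<subseteq> {..<n} \<and> card \<sigma> = k + 1. (f \<sigma>)\<^sup>2)"
proof -
  let ?T = "{\<tau>. \<tau> \<subseteq> {..<n} \<and> card \<tau> = k}" and ?F = "{\<sigma>. \<sigma> \<subseteq> {..<n} \<and> card \<sigma> = k + 1}"
  have fin: "finite \<sigma>" if "\<sigma> \<subseteq> {..<n}" for \<sigma> using that finite_subset by blast
  have sq: "localize f \<tau> u * localize f \<tau> u = (f (insert u \<tau>))\<^sup>2" for \<tau> u
  proof -
    have "localize f \<tau> u * localize f \<tau> u = (face_sign (insert u \<tau>) u * face_sign (insert u \<tau>) u)
        * (f (insert u \<tau>))\<^sup>2"
      unfolding localize_def power2_eq_square by (simp only: ac_simps)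
    then show ?thesis by simp
  qed
  have "(\<Sum>\<tau>\<in>?T. inner_on ({..<n} - \<tau>) (localize f \<tau>) (localize f \<tau>))
      = (\<Sum>(\<tau>, u)\<in>(SIGMA \<tau>:?T. {..<n} - \<tau>). (f (insert u \<tau>))\<^sup>2)"
    unfolding inner_on_def sq by (intro sum.Sigma) auto
  also have "\<dots> = (\<Sum>(\<sigma>, u)\<in>(SIGMA \<sigma>:?F. \<sigma>). (f \<sigma>)\<^sup>2)"
    by (rule sum.reindex_bij_witness[where i = "\<lambda>(\<sigma>, u). (\<sigma> - {u}, u)"
          and j = "\<lambda>(\<tau>, u). (insert u \<tau>, u)"])
      (auto simp: fin insert_absorb)
  also have "\<dots> = (\<Sum>\<sigma>\<in>?F. \<Sum>u\<in>\<sigma>. (f \<sigma>)\<^sup>2)"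
    by (intro sum.Sigma[symmetric]) (auto simp: fin)
  also have "\<dots> = real (k + 1) * (\<Sum>\<sigma>\<in>?F. (f \<sigma>)\<^sup>2)"
    by (simp add: sum_distrib_left)
  finally show ?thesis .
qed

text \<open>For a unit vector of the harmonic family, the degree-weighted mass is at least
  \<open>D / 2\<close> times its mass on faces of large degree, and Garland's identity bounds it by
  \<open>D / 4\<close> plus a term with matrix powers. Summed over the family, the remaining gap
  \<open>D / 4\<close> multiplies its size, each face of small degree carries total mass at most 1,
  and Bessel removes the family from the power term. Division by \<open>D / 4\<close> produces the
  factor 2.\<close>

lemma betti_le_local:
  fixes D :: real and j k n :: nat and s :: "nat set \<Rightarrow> real"
  assumes K: "K \<subseteq> nonempty_faces n"
    and closed: "\<And>\<sigma> \<tau>. \<sigma> \<in> K \<Longrightarrow> \<tau> \<subseteq> \<sigma> \<Longrightarrow> \<tau> \<noteq> {} \<Longrightarrow> \<tau> \<in> K"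
    and D: "D > 0" and s: "\<And>\<tau>. \<tau> \<subseteq> {..<n} \<Longrightarrow> card \<tau> = k \<Longrightarrow> 0 \<le> s \<tau>"
  shows "real (betti (int k) K)
    \<le> 2 * real (card {\<sigma> \<in> K. card \<sigma> = k + 1 \<and> real (face_degree n K \<sigma>) < D / 2})
      + (4 * real (k + 1) / D) ^ (2 * 2 ^ j)
        * (\<Sum>\<tau> | \<tau> \<subseteq> {..<n} \<and> card \<tau> = k. \<Sum>u\<in>{..<n} - \<tau>. \<Sum>w\<in>{..<n} - \<tau>.
            (mat_pow ({..<n} - \<tau>) (link_matrix K (s \<tau>) \<tau>) (2 ^ j) u w)\<^sup>2)"
proof -
  define F where "F = {\<sigma> \<in> K. card \<sigma> = k + 1}"
  define bad where "bad = {\<sigma> \<in> K. card \<sigma> = k + 1 \<and> real (face_degree n K \<sigma>) < D / 2}"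
  define T where "T = {\<tau>. \<tau> \<subseteq> {..<n} \<and> card \<tau> = k}"
  define N where "N \<tau> = {..<n} - \<tau>" for \<tau>
  define M where "M \<tau> = mat_pow (N \<tau>) (link_matrix K (s \<tau>) \<tau>) (2 ^ j)" for \<tau>
  \<comment> \<open>The localizations of a unit chain have total mass \<open>k + 1\<close>, so this
    choice makes the linear term of the quadratic form bound \<open>D / 4\<close>, half of the
    degree threshold.\<close>
  define \<epsilon> where "\<epsilon> = D / (4 * real (k + 1))"
  define f where "f = (Poly_Mapping.lookup :: chain \<Rightarrow> nat set \<Rightarrow> real)"
  define Q where "Q x = (\<Sum>\<tau>\<in>T. \<Sum>u\<in>N \<tau>. (\<Sum>w\<in>N \<tau>. M \<tau> u w * localize (f x) \<tau> w)\<^sup>2)" for x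
  have \<epsilon>: "\<epsilon> > 0" using D by (simp add: \<epsilon>_def)
  have finK: "finite K" using K by (rule finite_subset) simp
  then have finF: "finite F" by (simp add: F_def)
  have badF: "bad \<subseteq> F" by (auto simp: bad_def F_def)
  have finN: "finite (N \<tau>)" for \<tau> by (simp add: N_def)
  have FF: "{\<sigma> \<in> K. finite \<sigma> \<and> card \<sigma> = k + 1} = F"
    using K by (auto simp: F_def dest: nonempty_facesD)
  obtain H where H: "orthonormal F H" "H \<subseteq> cycles K (int k)"
    "\<forall>t\<in>H. \<forall>b\<in>boundaries K (int k). chain_inner F t b = 0" "betti (int k) K \<le> card H"
    by (rule betti_le_card_harmonic[OF closed finK, where k = k, unfolded FF])
  have bound: "D / 4 \<le> \<epsilon> / \<epsilon> ^ (2 * 2 ^ j) * Q x + D / 2 * (\<Sum>\<sigma>\<in>bad. (f x \<sigma>)\<^sup>2)"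
    if x: "x \<in> H" for x
  proof -
    have keys: "Poly_Mapping.keys x \<subseteq> F"
      using x H(2) by (fastforce simp: cycles_def chains_def F_def)
    have supp: "f x \<sigma> = 0" if "\<sigma> \<notin> F" for \<sigma>
      using keys that by (auto simp: f_def in_keys_iff)
    have unit: "(\<Sum>\<sigma>\<in>F. (f x \<sigma>)\<^sup>2) = 1"
      using H(1) x by (auto simp: orthonormal_def chain_inner_def power2_eq_square f_def)
    have "(\<Sum>\<sigma>\<in>F. real (face_degree n K \<sigma>) * (f x \<sigma>)\<^sup>2)
      = (\<Sum>\<tau>\<in>T. \<Sum>u\<in>N \<tau>. \<Sum>v\<in>N \<tau>.
        of_bool (u \<noteq> v \<and> insert u (insert v \<tau>) \<in> K) * localize (f x) \<tau> u * localize (f x) \<tau> v)"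
      unfolding F_def T_def N_def
    proof (rule garland_identity[where f = "f x", OF K closed])
      fix \<rho> assume "\<rho> \<in> K" "card \<rho> = k + 2"
      then show "(\<Sum>v\<in>\<rho>. face_sign \<rho> v * f x (\<rho> - {v})) = 0"
        unfolding f_def using H(3) x
        by (intro cocycle_condition[OF _ closed finK, where k = k]) (auto simp only: FF)
    qed
    also have "\<dots> \<le> (\<Sum>\<tau>\<in>T. inner_on (N \<tau>) (localize (f x) \<tau>)
        (apply_mat (N \<tau>) (link_matrix K (s \<tau>) \<tau>) (localize (f x) \<tau>)))"
    proof (intro sum_mono)
      fix \<tau> assume "\<tau> \<in> T"
      then have "(\<Sum>u\<in>N \<tau>. localize (f x) \<tau> u) = 0"
        unfolding f_def N_def T_def using x H(2) by (intro cycle_localize_sum[OF _ K]) auto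
      moreover have "localize (f x) \<tau> u = 0" if "insert u \<tau> \<notin> K" for u
        using that supp[of "insert u \<tau>"] by (simp add: localize_def F_def)
      ultimately show "(\<Sum>u\<in>N \<tau>. \<Sum>v\<in>N \<tau>. of_bool (u \<noteq> v \<and> insert u (insert v \<tau>) \<in> K)
          * localize (f x) \<tau> u * localize (f x) \<tau> v)
        \<le> inner_on (N \<tau>) (localize (f x) \<tau>)
          (apply_mat (N \<tau>) (link_matrix K (s \<tau>) \<tau>) (localize (f x) \<tau>))"
        using s[of \<tau>] \<open>\<tau> \<in> T\<close> unfolding T_def
        by (intro sum_adjacent_le_link_matrix[OF closed finN]) auto
    qed
    also have "\<dots> \<le> (\<Sum>\<tau>\<in>T. \<epsilon> * inner_on (N \<tau>) (localize (f x) \<tau>) (localize (f x) \<tau>)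
        + \<epsilon> / \<epsilon> ^ (2 * 2 ^ j) * (\<Sum>u\<in>N \<tau>. (\<Sum>w\<in>N \<tau>. M \<tau> u w * localize (f x) \<tau> w)\<^sup>2))"
    proof (intro sum_mono)
      fix \<tau>
      let ?L = "apply_mat (N \<tau>) (link_matrix K (s \<tau>) \<tau>)" and ?x = "localize (f x) \<tau>"
      have "inner_on (N \<tau>) ?x (?L ?x) \<le> \<epsilon> * inner_on (N \<tau>) ?x ?x
          + \<epsilon> / \<epsilon> ^ (2 * 2 ^ j) * inner_on (N \<tau>) ((?L ^^ (2 ^ j)) ?x) ((?L ^^ (2 ^ j)) ?x)"
        by (rule self_adjoint_quadratic_form_le[OF apply_mat_self_adjoint \<epsilon>]) (rule link_matrix_sym)
      also have "inner_on (N \<tau>) ((?L ^^ (2 ^ j)) ?x) ((?L ^^ (2 ^ j)) ?x)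
          = (\<Sum>u\<in>N \<tau>. (\<Sum>w\<in>N \<tau>. M \<tau> u w * ?x w)\<^sup>2)"
        by (simp add: inner_on_def funpow_apply_mat[OF finN] M_def power2_eq_square)
      finally show "inner_on (N \<tau>) ?x (?L ?x) \<le> \<epsilon> * inner_on (N \<tau>) ?x ?x
        + \<epsilon> / \<epsilon> ^ (2 * 2 ^ j) * (\<Sum>u\<in>N \<tau>. (\<Sum>w\<in>N \<tau>. M \<tau> u w * ?x w)\<^sup>2)" .
    qed
    also have "\<dots> = \<epsilon> * (\<Sum>\<tau>\<in>T. inner_on (N \<tau>) (localize (f x) \<tau>) (localize (f x) \<tau>))
        + \<epsilon> / \<epsilon> ^ (2 * 2 ^ j) * Q x"
      by (simp add: Q_def sum.distrib sum_distrib_left)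
    also have "(\<Sum>\<tau>\<in>T. inner_on (N \<tau>) (localize (f x) \<tau>) (localize (f x) \<tau>)) = real (k + 1)"
    proof -
      have "(\<Sum>\<sigma> | \<sigma> \<subseteq> {..<n} \<and> card \<sigma> = k + 1. (f x \<sigma>)\<^sup>2) = (\<Sum>\<sigma>\<in>F. (f x \<sigma>)\<^sup>2)"
        using K supp by (intro sum.mono_neutral_right) (auto simp: F_def nonempty_faces_def)
      moreover have "\<sigma> \<subseteq> {..<n} \<and> card \<sigma> = k + 1" if "f x \<sigma> \<noteq> 0" for \<sigma>
        using supp[of \<sigma>] that K by (auto simp: F_def nonempty_faces_def)
      ultimately show ?thesis
        using sum_localize_squares[of "f x" n k] unit by (simp add: T_def N_def)
    qed
    also have "\<epsilon> * real (k + 1) = D / 4" by (simp add: \<epsilon>_def field_simps)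
    finally have 1: "(\<Sum>\<sigma>\<in>F. real (face_degree n K \<sigma>) * (f x \<sigma>)\<^sup>2)
      \<le> D / 4 + \<epsilon> / \<epsilon> ^ (2 * 2 ^ j) * Q x" .
    have "D / 2 = (\<Sum>\<sigma>\<in>F. D / 2 * (f x \<sigma>)\<^sup>2)"
      unfolding sum_distrib_left[symmetric] unit by simp
    also have "\<dots> \<le> (\<Sum>\<sigma>\<in>F. real (face_degree n K \<sigma>) * (f x \<sigma>)\<^sup>2
        + (if \<sigma> \<in> bad then D / 2 * (f x \<sigma>)\<^sup>2 else 0))"
    proof (intro sum_mono)
      fix \<sigma> assume "\<sigma> \<in> F"
      then show "D / 2 * (f x \<sigma>)\<^sup>2 \<le> real (face_degree n K \<sigma>) * (f x \<sigma>)\<^sup>2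
          + (if \<sigma> \<in> bad then D / 2 * (f x \<sigma>)\<^sup>2 else 0)"
        using mult_right_mono[of "D / 2" "real (face_degree n K \<sigma>)" "(f x \<sigma>)\<^sup>2"]
        by (cases "\<sigma> \<in> bad") (simp_all add: bad_def F_def)
    qed
    also have "\<dots> = (\<Sum>\<sigma>\<in>F. real (face_degree n K \<sigma>) * (f x \<sigma>)\<^sup>2)
        + D / 2 * (\<Sum>\<sigma>\<in>bad. (f x \<sigma>)\<^sup>2)"
      using finF badF by (simp add: sum.distrib sum.inter_restrict[symmetric] Int_absorb1 sum_distrib_left)
    finally show ?thesis using 1 by linarith
  qed
  have "D / 4 * real (card H) = (\<Sum>x\<in>H. D / 4)" by simp
  also have "\<dots> \<le> (\<Sum>x\<in>H. \<epsilon> / \<epsilon> ^ (2 * 2 ^ j) * Q x + D / 2 * (\<Sum>\<sigma>\<in>bad. (f x \<sigma>)\<^sup>2))"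
    by (intro sum_mono bound)
  also have "\<dots> = \<epsilon> / \<epsilon> ^ (2 * 2 ^ j) * (\<Sum>x\<in>H. Q x) + D / 2 * (\<Sum>\<sigma>\<in>bad. \<Sum>x\<in>H. (f x \<sigma>)\<^sup>2)"
    unfolding sum.distrib sum_distrib_left[symmetric] by (subst sum.swap[of _ bad H]) (rule refl)
  also have "\<dots> \<le> \<epsilon> / \<epsilon> ^ (2 * 2 ^ j) * (\<Sum>\<tau>\<in>T. \<Sum>u\<in>N \<tau>. \<Sum>w\<in>N \<tau>. (M \<tau> u w)\<^sup>2)
      + D / 2 * (\<Sum>\<sigma>\<in>bad. 1)"
  proof (intro add_mono mult_left_mono sum_mono)
    fix \<sigma> assume "\<sigma> \<in> bad"
    then show "(\<Sum>x\<in>H. (f x \<sigma>)\<^sup>2) \<le> 1"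
      unfolding f_def using badF by (intro bessel_coordinate[OF H(1) finF]) auto
  next
    have "(\<Sum>x\<in>H. Q x)
        = (\<Sum>\<tau>\<in>T. \<Sum>u\<in>N \<tau>. \<Sum>x\<in>H. (\<Sum>w\<in>N \<tau>. M \<tau> u w * localize (f x) \<tau> w)\<^sup>2)"
      unfolding Q_def by (subst sum.swap, intro sum.cong refl, subst sum.swap) simp
    also have "\<dots> \<le> (\<Sum>\<tau>\<in>T. \<Sum>u\<in>N \<tau>. \<Sum>w\<in>N \<tau>. (M \<tau> u w)\<^sup>2)"
    proof (intro sum_mono)
      fix \<tau> u assume \<tau>: "\<tau> \<in> T" and "u \<in> N \<tau>"
      \<comment> \<open>Bessel sees only coordinates in \<open>F\<close>, so the sum is restricted
        to the vertices that yield such a coordinate; at all others every member of the family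
        vanishes.\<close>
      define W where "W = {w \<in> N \<tau>. insert w \<tau> \<in> F}"
      define g where "g w = M \<tau> u w * face_sign (insert w \<tau>) w" for w
      have "(\<Sum>w\<in>N \<tau>. M \<tau> u w * localize (f x) \<tau> w) = (\<Sum>w\<in>W. f x (insert w \<tau>) * g w)"
        if "x \<in> H" for x
      proof -
        have "Poly_Mapping.keys x \<subseteq> F"
          using that H(2) by (fastforce simp: cycles_def chains_def F_def)
        then have "f x (insert w \<tau>) = 0" if "insert w \<tau> \<notin> F" for w
          using that by (auto simp: f_def in_keys_iff)
        then show ?thesis
          using finN by (intro sum.mono_neutral_cong_right) (auto simp: W_def g_def localize_def)
      qed
      then have "(\<Sum>x\<in>H. (\<Sum>w\<in>N \<tau>. M \<tau> u w * localize (f x) \<tau> w)\<^sup>2)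
          = (\<Sum>x\<in>H. (\<Sum>w\<in>W. f x (insert w \<tau>) * g w)\<^sup>2)"
        by simp
      also have "\<dots> \<le> (\<Sum>w\<in>W. (g w)\<^sup>2)"
        unfolding f_def
        by (rule bessel_reindex[OF H(1) finF]) (auto simp: W_def N_def inj_on_def)
      also have "\<dots> = (\<Sum>w\<in>W. (M \<tau> u w)\<^sup>2)"
        by (simp add: g_def power_mult_distrib power2_eq_square[of "face_sign _ _"])
      also have "\<dots> \<le> (\<Sum>w\<in>N \<tau>. (M \<tau> u w)\<^sup>2)"
        using finN by (intro sum_mono2) (auto simp: W_def)
      finally show "(\<Sum>x\<in>H. (\<Sum>w\<in>N \<tau>. M \<tau> u w * localize (f x) \<tau> w)\<^sup>2)
          \<le> (\<Sum>w\<in>N \<tau>. (M \<tau> u w)\<^sup>2)" .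
    qed
    finally show "(\<Sum>x\<in>H. Q x) \<le> (\<Sum>\<tau>\<in>T. \<Sum>u\<in>N \<tau>. \<Sum>w\<in>N \<tau>. (M \<tau> u w)\<^sup>2)" .
  qed (use D \<epsilon> in auto)
  finally have 2: "D / 4 * real (card H)
    \<le> \<epsilon> / \<epsilon> ^ (2 * 2 ^ j) * (\<Sum>\<tau>\<in>T. \<Sum>u\<in>N \<tau>. \<Sum>w\<in>N \<tau>. (M \<tau> u w)\<^sup>2) + D / 2 * real (card bad)"
    by simp
  let ?S = "\<Sum>\<tau>\<in>T. \<Sum>u\<in>N \<tau>. \<Sum>w\<in>N \<tau>. (M \<tau> u w)\<^sup>2"
  have S: "0 \<le> ?S" by (intro sum_nonneg) auto
  have "real (card H) = 4 / D * (D / 4 * real (card H))" using D by simp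
  also have "\<dots> \<le> 4 / D * (\<epsilon> / \<epsilon> ^ (2 * 2 ^ j) * ?S + D / 2 * real (card bad))"
    using 2 D by (intro mult_left_mono) auto
  also have "\<dots> = 2 * real (card bad) + (1 / real (k + 1)) * ((1 / \<epsilon> ^ (2 * 2 ^ j)) * ?S)"
  proof -
    have "4 / D * \<epsilon> = 1 / real (k + 1)"
      using D by (simp add: \<epsilon>_def divide_eq_eq)
    moreover have "4 / D * (\<epsilon> / \<epsilon> ^ (2 * 2 ^ j) * ?S + D / 2 * real (card bad))
        = 4 / D * (D / 2) * real (card bad) + 4 / D * \<epsilon> * ((1 / \<epsilon> ^ (2 * 2 ^ j)) * ?S)"
      by (simp add: distrib_left)
    moreover have "4 / D * (D / 2) = 2" using D by simp
    ultimately show ?thesis by (simp only:)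
  qed
  also have "\<dots> \<le> 2 * real (card bad) + 1 * ((1 / \<epsilon> ^ (2 * 2 ^ j)) * ?S)"
    using S \<epsilon> by (intro add_left_mono mult_right_mono) auto
  also have "1 / \<epsilon> ^ (2 * 2 ^ j) = (4 * real (k + 1) / D) ^ (2 * 2 ^ j)"
    by (simp add: \<epsilon>_def power_divide)
  finally show ?thesis
    using H(4) unfolding bad_def T_def N_def M_def by simp
qed

section \<open>Expectations\<close>

lemma link_prob_bounds:
  assumes p: "\<forall>i<n. 0 \<le> p i \<and> p i \<le> (1 :: real)" and "finite \<tau>" "card \<tau> + a < n"
  shows "0 \<le> link_prob p a \<tau>" "link_prob p a \<tau> \<le> 1"
proof -
  have "card \<alpha> + a < n" if "\<alpha> \<subseteq> \<tau>" for \<alpha>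
    using card_mono[OF assms(2) that] assms(3) by simp
  then show "0 \<le> link_prob p a \<tau>" "link_prob p a \<tau> \<le> 1"
    unfolding link_prob_def using p by (auto intro!: prod_nonneg prod_le_1)
qed

lemma mem_coin_complex_iff_heads:
  assumes "\<sigma> \<in> nonempty_faces n"
  shows "\<sigma> \<in> coin_complex n c \<longleftrightarrow> heads c (coin_group \<sigma> {})"
  using Un_mem_coin_complex_iff[of \<sigma> n "{}" c] assms by (simp add: nonempty_faces_def)

lemma insert_mem_coin_complex_iff:
  assumes "\<tau> \<subseteq> {..<n}" "u < n"
  shows "insert u \<tau> \<in> coin_complex n c
    \<longleftrightarrow> heads c (coin_group \<tau> {}) \<and> heads c (coin_group \<tau> {u})"
  using Un_mem_coin_complex_iff[of \<tau> n "{u}" c] assms by (auto simp: subset_singleton_iff)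

lemma insert2_mem_coin_complex_iff:
  assumes "\<tau> \<subseteq> {..<n}" "u < n" "v < n"
  shows "insert u (insert v \<tau>) \<in> coin_complex n c
    \<longleftrightarrow> heads c (coin_group \<tau> {}) \<and> heads c (coin_group \<tau> {u}) \<and> heads c (coin_group \<tau> {v})
      \<and> heads c (coin_group \<tau> {u, v})"
proof -
  have "y \<subseteq> {u, v} \<longleftrightarrow> y = {} \<or> y = {u} \<or> y = {v} \<or> y = {u, v}" for y by auto
  then show ?thesis
    using Un_mem_coin_complex_iff[of \<tau> n "{u, v}" c] assms by auto
qed

lemma expectation_mem_coin_complex:
  assumes p: "\<forall>i<n. 0 \<le> p i \<and> p i \<le> (1 :: real)" and \<sigma>: "\<sigma> \<subseteq> {..<n}" "card \<sigma> = k + 1"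
  shows "measure_pmf.expectation (coins n p) (\<lambda>c. of_bool (\<sigma> \<in> coin_complex n c)) = qq p k"
proof -
  have ne: "\<sigma> \<in> nonempty_faces n" using \<sigma> by (auto simp: nonempty_faces_def)
  show ?thesis
    unfolding mem_coin_complex_iff_heads[OF ne]
    using expectation_heads[OF p coin_group_subset[OF \<sigma>(1)], of "{}" of_bool]
      face_prob_eq_qq[OF nonempty_facesD(1)[OF ne] \<sigma>(2)]
    by (simp add: group_prob_empty)
qed

lemma qq_rr_nonneg:
  assumes p: "\<forall>i<n. 0 \<le> p i \<and> p i \<le> (1 :: real)" and "n \<ge> k + 2"
  shows "0 \<le> qq p k" "0 \<le> rr p k" "rr p k \<le> 1"
proof -
  have p': "0 \<le> p i \<and> p i \<le> 1" if "i \<le> k + 1" for i using p that assms(2) by auto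
  show "0 \<le> qq p k" unfolding qq_def using p' by (intro prod_nonneg) auto
  show "0 \<le> rr p k" unfolding rr_eq_prod using p' by (intro prod_nonneg) auto
  show "rr p k \<le> 1" unfolding rr_eq_prod using p' by (intro prod_le_1) (auto intro: power_le_one)
qed

section \<open>Chernoff bound for faces of small degree\<close>

text \<open>Markov's inequality for \<open>2 ^ (- degree)\<close>, a product over the independent coin groups of the
  vertices outside \<open>\<sigma>\<close>.\<close>

lemma expectation_low_degree:
  assumes p: "\<forall>i<n. 0 \<le> p i \<and> p i \<le> (1 :: real)" and \<sigma>: "\<sigma> \<subseteq> {..<n}" "card \<sigma> = k + 1"
    and n: "n \<ge> k + 2" and D: "D = real (n - k - 1) * rr p k"
  shows "measure_pmf.expectation (coins n p) (\<lambda>c. of_bool (\<sigma> \<in> coin_complex n c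
      \<and> real (face_degree n (coin_complex n c) \<sigma>) < D / 2)) \<le> qq p k * exp (- ((1 - ln 2) / 2 * D))"
proof -
  define N where "N = {..<n} - \<sigma>"
  define I where "I = insert {} ((\<lambda>v. {v}) ` N)"
  \<comment> \<open>The group of \<open>{}\<close> decides whether \<open>\<sigma>\<close> is a
    face. Given that, the vertex groups showing heads are the cofaces, each worth
    \<open>1 / 2\<close>.\<close>
  define \<phi> where "\<phi> x b = (if x = {} then of_bool b else if b then 1 / 2 else 1 :: real)"
    for x :: "nat set" and b
  have fin\<sigma>: "finite \<sigma>" using \<sigma>(1) finite_subset by blast
  have ne: "\<sigma> \<in> nonempty_faces n" using \<sigma> by (auto simp: nonempty_faces_def)
  have finN: "finite N" "card N = n - k - 1"
    using \<sigma> fin\<sigma> by (simp_all add: N_def card_Diff_subset)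
  have prod_I: "(\<Prod>x\<in>I. h x) = h {} * (\<Prod>v\<in>N. h {v})" for h :: "nat set \<Rightarrow> real"
    unfolding I_def using finN by (subst prod.insert) (auto simp: prod.reindex inj_on_def)
  have r: "0 \<le> rr p k" "rr p k \<le> 1" using qq_rr_nonneg[OF p n] by auto
  have le: "of_bool (\<sigma> \<in> coin_complex n c \<and> real (face_degree n (coin_complex n c) \<sigma>) < D / 2)
      \<le> 2 powr (D / 2) * (\<Prod>x\<in>I. \<phi> x (heads c (coin_group \<sigma> x)))" for c
  proof (cases "\<sigma> \<in> coin_complex n c \<and> real (face_degree n (coin_complex n c) \<sigma>) < D / 2")
    case True
    have h: "heads c (coin_group \<sigma> {})" using True mem_coin_complex_iff_heads[OF ne] by simp
    have "{v \<in> N. heads c (coin_group \<sigma> {v})} = {v \<in> {..<n} - \<sigma>. insert v \<sigma> \<in> coin_complex n c}"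
      using h insert_mem_coin_complex_iff[OF \<sigma>(1)] by (auto simp: N_def)
    then have deg: "face_degree n (coin_complex n c) \<sigma> = card {v \<in> N. heads c (coin_group \<sigma> {v})}"
      by (simp add: face_degree_def)
    have "(\<Prod>x\<in>I. \<phi> x (heads c (coin_group \<sigma> x)))
        = (\<Prod>v\<in>N. if heads c (coin_group \<sigma> {v}) then 1 / 2 else 1)"
      unfolding prod_I by (simp add: \<phi>_def h)
    also have "\<dots> = (1 / 2) ^ face_degree n (coin_complex n c) \<sigma>"
      using finN(1) by (simp add: prod.If_cases deg Int_def)
    also have "\<dots> = 2 powr (- real (face_degree n (coin_complex n c) \<sigma>))"
      by (simp add: powr_minus powr_realpow power_one_over inverse_eq_divide)
    finally have "2 powr (D / 2) * (\<Prod>x\<in>I. \<phi> x (heads c (coin_group \<sigma> x)))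
        = 2 powr (D / 2 - real (face_degree n (coin_complex n c) \<sigma>))"
      by (simp flip: powr_add)
    also have "\<dots> \<ge> 2 powr 0" using True by (intro powr_mono) auto
    finally show ?thesis using True by simp
  qed (auto simp: \<phi>_def intro!: prod_nonneg mult_nonneg_nonneg)
  have "measure_pmf.expectation (coins n p) (\<lambda>c. \<Prod>x\<in>I. \<phi> x (heads c (coin_group \<sigma> x)))
      = (\<Prod>x\<in>I. group_prob p (coin_group \<sigma> x) * \<phi> x True
          + (1 - group_prob p (coin_group \<sigma> x)) * \<phi> x False)"
    using finN \<sigma> by (intro expectation_prod_heads[OF p] coin_group_subset coin_group_disjoint)
      (auto simp: I_def N_def)
  also have "\<dots> = qq p k * (\<Prod>v\<in>N. 1 - rr p k / 2)"
  proof -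
    have "group_prob p (coin_group \<sigma> {v}) = rr p k" if "v \<in> N" for v
      using that fin\<sigma> link_prob_eq_rr[OF fin\<sigma> \<sigma>(2)] group_prob_link[of \<sigma> "{v}" 0 p]
      by (simp add: N_def)
    then have "(\<Prod>v\<in>N. group_prob p (coin_group \<sigma> {v}) * \<phi> {v} True
        + (1 - group_prob p (coin_group \<sigma> {v})) * \<phi> {v} False) = (\<Prod>v\<in>N. 1 - rr p k / 2)"
      by (intro prod.cong refl) (simp add: \<phi>_def)
    then show ?thesis
      unfolding prod_I by (simp add: \<phi>_def group_prob_empty face_prob_eq_qq[OF fin\<sigma> \<sigma>(2)])
  qed
  also have "\<dots> = qq p k * (1 - rr p k / 2) ^ (n - k - 1)"
    using finN by simp
  also have "\<dots> \<le> qq p k * exp (- (rr p k / 2)) ^ (n - k - 1)"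
    using qq_rr_nonneg[OF p n] exp_ge_add_one_self[of "- (rr p k / 2)"]
    by (intro mult_left_mono power_mono) auto
  also have "exp (- (rr p k / 2)) ^ (n - k - 1) = exp (- (D / 2))"
    unfolding exp_of_nat_mult[symmetric] D by simp
  finally have E: "measure_pmf.expectation (coins n p) (\<lambda>c. \<Prod>x\<in>I. \<phi> x (heads c (coin_group \<sigma> x)))
    \<le> qq p k * exp (- (D / 2))" .
  have "measure_pmf.expectation (coins n p) (\<lambda>c. of_bool (\<sigma> \<in> coin_complex n c
      \<and> real (face_degree n (coin_complex n c) \<sigma>) < D / 2))
    \<le> measure_pmf.expectation (coins n p)
        (\<lambda>c. 2 powr (D / 2) * (\<Prod>x\<in>I. \<phi> x (heads c (coin_group \<sigma> x))))"
    by (intro integral_mono integrable_coins le)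
  also have "\<dots> \<le> 2 powr (D / 2) * (qq p k * exp (- (D / 2)))"
    using E by simp
  \<comment> \<open>The Markov factor costs \<open>ln 2 / 2 * D\<close> in the exponent against the
    gain \<open>D / 2\<close>; the difference is favourable because \<open>ln 2 < 1\<close>.\<close>
  also have "\<dots> = qq p k * exp (- ((1 - ln 2) / 2 * D))"
    by (simp add: powr_def exp_add[symmetric] field_simps)
  finally show ?thesis .
qed

section \<open>Moments of the centred link matrices\<close>

lemma mat_pow_cong:
  assumes "\<And>u v. u \<in> N \<Longrightarrow> v \<in> N \<Longrightarrow> S u v = S' u v" "u \<in> N"
  shows "mat_pow N S m u w = mat_pow N S' m u w"
  using assms(2) by (induction m arbitrary: u) (auto simp: assms(1) intro!: sum.cong)

text \<open>The deviations of a 0-1 variable from its mean are at most 1 in absolute value, so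
  higher absolute central moments are at most the variance \<open>s * (1 - s)\<close>.\<close>

lemma centred_moment_le:
  assumes "0 \<le> s" "s \<le> (1 :: real)" "m \<ge> 2"
  shows "\<bar>s * (1 - s) ^ m + (1 - s) * (- s) ^ m\<bar> \<le> s"
proof -
  have "\<bar>s * (1 - s) ^ m + (1 - s) * (- s) ^ m\<bar> \<le> s * (1 - s) ^ m + (1 - s) * s ^ m"
    using assms abs_triangle_ineq[of "s * (1 - s) ^ m" "(1 - s) * (- s) ^ m"]
    by (simp add: abs_mult power_abs)
  also have "\<dots> \<le> s * (1 - s) ^ 2 + (1 - s) * s ^ 2"
    using assms by (intro add_mono mult_left_mono power_decreasing) auto
  also have "\<dots> = s * (1 - s)" by (simp add: power2_eq_square algebra_simps)
  also have "\<dots> \<le> s" using assms by (simp add: mult_left_le)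
  finally show ?thesis .
qed

text \<open>Only closed walks that traverse each of their edges at least twice contribute.\<close>

lemma expectation_closed_walk_le:
  fixes n t :: nat and \<tau> :: "nat set"
  assumes p: "\<forall>i<n. 0 \<le> p i \<and> p i \<le> (1 :: real)" and \<tau>: "\<tau> \<subseteq> {..<n}"
    and ys: "set ys \<subseteq> {..<n} - \<tau>" "length ys = 2 * t" "t \<ge> 1"
    and s: "s = link_prob p 1 \<tau>" "0 \<le> s" "s \<le> 1"
    and S: "\<And>c u v. S c u v = (if u = v then 0 else of_bool (heads c (coin_group \<tau> {}))
      * of_bool (heads c (coin_group \<tau> {u})) * of_bool (heads c (coin_group \<tau> {v}))
      * (of_bool (heads c (coin_group \<tau> {u, v})) - s))"
    and nonneg: "0 \<le> face_prob p \<tau>" "0 \<le> link_prob p 0 \<tau>"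
  shows "measure_pmf.expectation (coins n p) (\<lambda>c. path_weight (S c) (ys @ [hd ys]))
    \<le> (if card (set ys) \<le> t + 1
        then face_prob p \<tau> * link_prob p 0 \<tau> ^ card (set ys) * s ^ (card (set ys) - 1) else 0)"
proof -
  define zs where "zs = ys @ [hd ys]"
  define es where "es = path_edges zs"
  define E where "E = set es"
  define V where "V = set ys"
  have ne: "ys \<noteq> []" using ys by auto
  have zs: "set zs = V" "length zs = 2 * t + 1"
    using ne ys by (auto simp: zs_def V_def)
  have len: "length es = 2 * t" using zs by (simp add: es_def)
  have RHS: "0 \<le> (if card V \<le> t + 1
        then face_prob p \<tau> * link_prob p 0 \<tau> ^ card V * s ^ (card V - 1) else 0)"
    using nonneg s by (auto intro!: mult_nonneg_nonneg)
  have fin\<tau>: "finite \<tau>" using \<tau> finite_subset by blast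
  show ?thesis
  proof (cases "\<forall>e\<in>E. card e = 2")
    case False
    then obtain e where "e \<in> E" "card e \<noteq> 2" by blast
    then have "path_weight (S c) zs = 0" for c
      by (intro path_weight_eq_0[of _ e]) (auto simp: S E_def es_def)
    then show ?thesis using RHS unfolding zs_def V_def by simp
  next
    case True
    \<comment> \<open>The groups belong to sets of 0, 1 and 2 vertices outside
      \<open>\<tau>\<close>, so they are distinct and independent. The case distinction on
      \<open>card x\<close> in \<open>\<phi>\<close> separates the indicators from the centred edge
      factors.\<close>
    define I where "I = insert {} ((\<lambda>u. {u}) ` V \<union> E)"
    define \<phi> where "\<phi> x b = (if card x \<le> 1 then of_bool b else (of_bool b - s) ^ count_list es x)"
      for x :: "nat set" and b
    have E1: "e \<noteq> {}" "\<And>u. e \<noteq> {u}" if "e \<in> E" for e using True that by auto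
    have sub: "e \<subseteq> V" if "e \<in> E" for e
      using that path_edges_subset[of e zs] zs by (simp add: E_def es_def)
    have VN: "V \<subseteq> {..<n} - \<tau>" using ys by (simp add: V_def)
    have prod_I: "(\<Prod>x\<in>I. h x) = h {} * (\<Prod>u\<in>V. h {u}) * (\<Prod>e\<in>E. h e)"
      for h :: "nat set \<Rightarrow> real"
    proof -
      have "(\<Prod>x\<in>I. h x) = h {} * (\<Prod>x\<in>(\<lambda>u. {u}) ` V \<union> E. h x)"
        unfolding I_def using E1 by (subst prod.insert) (auto simp: V_def E_def)
      also have "(\<Prod>x\<in>(\<lambda>u. {u}) ` V \<union> E. h x) = (\<Prod>x\<in>(\<lambda>u. {u}) ` V. h x) * (\<Prod>e\<in>E. h e)"
        using E1 by (intro prod.union_disjoint) (auto simp: V_def E_def)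
      also have "(\<Prod>x\<in>(\<lambda>u. {u}) ` V. h x) = (\<Prod>u\<in>V. h {u})"
        by (subst prod.reindex) (auto simp: inj_on_def)
      finally show ?thesis by (simp add: mult.assoc)
    qed
    have "path_weight (S c) zs = (\<Prod>x\<in>I. \<phi> x (heads c (coin_group \<tau> x)))" for c
    proof -
      have "path_weight (S c) zs = of_bool (heads c (coin_group \<tau> {}))
          * (\<Prod>u\<in>V. of_bool (heads c (coin_group \<tau> {u})))
          * (\<Prod>e\<in>E. (of_bool (heads c (coin_group \<tau> e)) - s) ^ count_list es e)"
        unfolding E_def es_def zs(1)[symmetric]
        by (rule path_weight_factor[where g = "\<lambda>e. of_bool (heads c (coin_group \<tau> e)) - s"
              and y = "\<lambda>u. of_bool (heads c (coin_group \<tau> {u}))"])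
          (use True zs ys in \<open>auto simp: S E_def es_def\<close>)
      also have "\<dots> = (\<Prod>x\<in>I. \<phi> x (heads c (coin_group \<tau> x)))"
        unfolding prod_I using True by (simp add: \<phi>_def)
      finally show ?thesis .
    qed
    then have "measure_pmf.expectation (coins n p) (\<lambda>c. path_weight (S c) zs)
        = (\<Prod>x\<in>I. group_prob p (coin_group \<tau> x) * \<phi> x True
            + (1 - group_prob p (coin_group \<tau> x)) * \<phi> x False)"
    proof (simp only:, intro expectation_prod_heads[OF p] coin_group_subset coin_group_disjoint \<tau>)
      show "finite I" by (simp add: I_def V_def E_def)
      show "x \<subseteq> {..<n}" if "x \<in> I" for x using that sub VN by (auto simp: I_def)
      show "x \<inter> \<tau> = {}" if "x \<in> I" for x using that sub VN by (auto simp: I_def)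
    qed
    also have "\<dots> = face_prob p \<tau> * link_prob p 0 \<tau> ^ card V
        * (\<Prod>e\<in>E. s * (1 - s) ^ count_list es e + (1 - s) * (- s) ^ count_list es e)"
    proof -
      have "group_prob p (coin_group \<tau> {u}) = link_prob p 0 \<tau>" if "u \<in> V" for u
        using that VN by (intro group_prob_link fin\<tau>) auto
      moreover have "group_prob p (coin_group \<tau> e) = s" if "e \<in> E" for e
        unfolding s using that VN sub[OF that] True by (intro group_prob_link fin\<tau>) auto
      ultimately show ?thesis
        unfolding prod_I using True by (simp add: \<phi>_def group_prob_empty)
    qed
    finally have eq: "measure_pmf.expectation (coins n p) (\<lambda>c. path_weight (S c) zs)
      = face_prob p \<tau> * link_prob p 0 \<tau> ^ card V
        * (\<Prod>e\<in>E. s * (1 - s) ^ count_list es e + (1 - s) * (- s) ^ count_list es e)" .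
    show ?thesis
    proof (cases "\<exists>e\<in>E. count_list es e = 1")
      case True
      then obtain e where "e \<in> E" "count_list es e = 1" by blast
      \<comment> \<open>An edge traversed once contributes the mean of a centred variable,
        \<open>s * (1 - s) + (1 - s) * (- s) = 0\<close>.\<close>
      then have "(\<Prod>e\<in>E. s * (1 - s) ^ count_list es e + (1 - s) * (- s) ^ count_list es e) = 0"
        by (intro prod_zero bexI[of _ e]) (auto simp: E_def)
      then show ?thesis using eq RHS unfolding zs_def V_def by simp
    next
      case False
      have "2 * card E \<le> 2 * t"
        using twice_card_edges_le[of es] False len by (auto simp: E_def)
      moreover have cV: "card V \<le> Suc (card E)"
        using card_vertices_le_card_edges[of zs] zs by (simp add: E_def es_def)
      ultimately have cVt: "card V \<le> t + 1" by simp
      have "(\<Prod>e\<in>E. s * (1 - s) ^ count_list es e + (1 - s) * (- s) ^ count_list es e)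
          \<le> \<bar>\<Prod>e\<in>E. s * (1 - s) ^ count_list es e + (1 - s) * (- s) ^ count_list es e\<bar>"
        by simp
      also have "\<dots> \<le> (\<Prod>e\<in>E. s)"
        unfolding abs_prod
      proof (intro prod_mono conjI abs_ge_zero centred_moment_le s)
        fix e assume "e \<in> E"
        then have "count_list es e \<noteq> 0" "count_list es e \<noteq> 1"
          using False by (auto simp: E_def count_list_0_iff)
        then show "2 \<le> count_list es e" by linarith
      qed
      \<comment> \<open>Connectedness of the walk gives \<open>card V - 1 \<le> card E\<close>, and
        \<open>s \<le> 1\<close> allows the exponent to be lowered.\<close>
      also have "\<dots> \<le> s ^ (card V - 1)"
        using s cV by (simp add: power_decreasing)
      finally show ?thesis
        using eq cVt nonneg by (auto simp: zs_def V_def intro!: mult_left_mono)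
    qed
  qed
qed

text \<open>With \<open>a\<close> and \<open>s\<close> the probabilities of a link vertex and a link
  edge, a walk on \<open>i\<close> vertices contributes at most \<open>face_prob p \<tau> * a ^ i *
  s ^ (i - 1) = qq p k * rr p k ^ (i - 1)\<close>. There are at most
  \<open>n ^ i * (t + 1) ^ (2 * t)\<close> such walks. As \<open>n * rr p k \<ge> 1\<close>, the
  term \<open>i = t + 1\<close> dominates, and summing over \<open>i\<close> costs one more factor
  \<open>t + 1\<close>.\<close>

lemma expectation_link_matrix_pow:
  fixes n t k :: nat
  assumes p: "\<forall>i<n. 0 \<le> p i \<and> p i \<le> (1 :: real)" and \<tau>: "\<tau> \<subseteq> {..<n}" "card \<tau> = k"
    and n: "n \<ge> k + 2" and t: "t \<ge> 1" and R: "real n * rr p k \<ge> 1"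
  shows "measure_pmf.expectation (coins n p) (\<lambda>c. \<Sum>u\<in>{..<n} - \<tau>. \<Sum>w\<in>{..<n} - \<tau>.
      (mat_pow ({..<n} - \<tau>) (link_matrix (coin_complex n c) (link_prob p 1 \<tau>) \<tau>) t u w)\<^sup>2)
    \<le> real (t + 1) ^ (2 * t + 1) * (qq p k * real n * (real n * rr p k) ^ t)"
proof -
  define N where "N = {..<n} - \<tau>"
  define s where "s = link_prob p 1 \<tau>"
  define a where "a = link_prob p 0 \<tau>"
  define S where "S c u v = (if u = v then 0 else of_bool (heads c (coin_group \<tau> {}))
      * of_bool (heads c (coin_group \<tau> {u})) * of_bool (heads c (coin_group \<tau> {v}))
      * (of_bool (heads c (coin_group \<tau> {u, v})) - s))" for c and u v :: nat
  define L where "L = {ys. set ys \<subseteq> N \<and> length ys = 2 * t}"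
  define b where "b i = (if i \<le> t + 1 then face_prob p \<tau> * a ^ i * s ^ (i - 1) else 0)" for i :: nat
  have finN: "finite N" by (simp add: N_def)
  have finL: "finite L" unfolding L_def by (rule finite_lists_length_eq[OF finN])
  have fin\<tau>: "finite \<tau>" using \<tau>(1) finite_subset by blast
  \<comment> \<open>Any vertex outside \<open>\<tau>\<close> serves to express \<open>a * s\<close>
    and \<open>face_prob p \<tau> * a\<close> through a set with \<open>k + 1\<close> elements,
    where \<open>rr p k\<close> and \<open>qq p k\<close> are available.\<close>
  have "card ({..<n} - \<tau>) > 0" using \<tau> n fin\<tau> by (simp add: card_Diff_subset)
  then obtain v where v: "v < n" "v \<notin> \<tau>" by (auto simp: card_gt_0_iff)
  have cv: "finite (insert v \<tau>)" "card (insert v \<tau>) = k + 1" using v fin\<tau> \<tau> by auto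
  have as: "a * s = rr p k"
    using link_prob_insert[OF fin\<tau> v(2), of p 0] link_prob_eq_rr[OF cv, of p]
    by (simp add: a_def s_def)
  have fa: "face_prob p \<tau> * a = qq p k"
    using face_prob_insert[OF fin\<tau> v(2), of p] face_prob_eq_qq[OF cv, of p] by (simp add: a_def)
  have pos: "0 \<le> p i \<and> p i \<le> 1" if "i \<le> k + 1" for i using p n that by auto
  have card\<tau>: "card \<alpha> \<le> k" if "\<alpha> \<subseteq> \<tau>" for \<alpha> using card_mono[OF fin\<tau> that] \<tau>(2) by simp
  have s01: "0 \<le> s" "s \<le> 1" and a0: "0 \<le> a"
    unfolding s_def a_def using link_prob_bounds[OF p fin\<tau>] \<tau>(2) n by auto
  have f0: "0 \<le> face_prob p \<tau>"
    unfolding face_prob_def using pos card\<tau> by (intro prod_nonneg) (auto simp: le_diff_conv le_SucI)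
  have link: "link_matrix (coin_complex n c) s \<tau> u w = S c u w" if "u \<in> N" "w \<in> N" for c u w
  proof -
    have "u < n" "w < n" using that by (auto simp: N_def)
    then show ?thesis
      unfolding link_matrix_def S_def insert2_mem_coin_complex_iff[OF \<tau>(1) \<open>u < n\<close> \<open>w < n\<close>]
        insert_mem_coin_complex_iff[OF \<tau>(1) \<open>u < n\<close>] insert_mem_coin_complex_iff[OF \<tau>(1) \<open>w < n\<close>]
      by auto
  qed
  have sym: "S c u w = S c w u" for c u w by (simp add: S_def insert_commute)
  have "(\<Sum>u\<in>N. \<Sum>w\<in>N. (mat_pow N (link_matrix (coin_complex n c) s \<tau>) t u w)\<^sup>2)
      = (\<Sum>ys\<in>L. path_weight (S c) (ys @ [hd ys]))" for c
  proof -
    have "mat_pow N (link_matrix (coin_complex n c) s \<tau>) t u w = mat_pow N (S c) t u w"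
      if "u \<in> N" for u w
      by (rule mat_pow_cong[OF link that])
    then show ?thesis
      using sum_mat_pow_squares[where S = "S c", OF finN sym t] by (simp add: L_def)
  qed
  then have "measure_pmf.expectation (coins n p) (\<lambda>c. \<Sum>u\<in>N. \<Sum>w\<in>N.
      (mat_pow N (link_matrix (coin_complex n c) s \<tau>) t u w)\<^sup>2)
    = (\<Sum>ys\<in>L. measure_pmf.expectation (coins n p) (\<lambda>c. path_weight (S c) (ys @ [hd ys])))"
    by simp
  also have "\<dots> \<le> (\<Sum>ys\<in>L. b (card (set ys)))"
    unfolding b_def a_def
  proof (intro sum_mono expectation_closed_walk_le[OF p \<tau>(1) _ _ t s_def s01])
    show "S c u v = (if u = v then 0 else of_bool (heads c (coin_group \<tau> {}))
      * of_bool (heads c (coin_group \<tau> {u})) * of_bool (heads c (coin_group \<tau> {v}))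
      * (of_bool (heads c (coin_group \<tau> {u, v})) - s))" for c u v by (rule S_def)
  qed (use f0 a0 in \<open>auto simp: L_def N_def a_def\<close>)
  also have "\<dots> = (\<Sum>i\<in>{1..2 * t}. \<Sum>ys | ys \<in> L \<and> card (set ys) = i. b (card (set ys)))"
  proof (rule sum.group[symmetric, OF finL])
    have "card (set ys) \<le> 2 * t" "0 < card (set ys)" if "ys \<in> L" for ys
      using that t card_length[of ys] by (auto simp: L_def card_gt_0_iff)
    then show "(\<lambda>ys. card (set ys)) ` L \<subseteq> {1..2 * t}"
      by (simp add: image_subset_iff Suc_le_eq)
  qed simp
  also have "\<dots> = (\<Sum>i\<in>{1..2 * t}. real (card {ys. ys \<in> L \<and> card (set ys) = i}) * b i)"
    by (intro sum.cong refl) simp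
  also have "\<dots> = (\<Sum>i\<in>{1..t + 1}. real (card {ys. ys \<in> L \<and> card (set ys) = i}) * b i)"
    using t by (intro sum.mono_neutral_cong) (auto simp: b_def)
  also have "\<dots> \<le> (\<Sum>i\<in>{1..t + 1}. real (t + 1) ^ (2 * t) * (qq p k * real n * (real n * rr p k) ^ t))"
  proof (intro sum_mono)
    fix i assume i: "i \<in> {1..t + 1}"
    then obtain i' where i': "i = Suc i'" "i' \<le> t" by (cases i) auto
    have "card {ys. ys \<in> L \<and> card (set ys) = i} \<le> card N ^ i * i ^ (2 * t)"
      using card_lists_card_set_le[OF finN, of "2 * t" i] by (simp add: L_def conj_assoc)
    also have "\<dots> \<le> n ^ i * (t + 1) ^ (2 * t)"
      using i card_mono[of "{..<n}" N] by (intro mult_mono power_mono) (auto simp: N_def)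
    finally have "real (card {ys. ys \<in> L \<and> card (set ys) = i}) \<le> real (n ^ i * (t + 1) ^ (2 * t))"
      by (rule of_nat_mono)
    then have "real (card {ys. ys \<in> L \<and> card (set ys) = i}) * b i
        \<le> real (n ^ i * (t + 1) ^ (2 * t)) * b i"
      using f0 a0 s01 by (intro mult_right_mono) (auto simp: b_def)
    also have "\<dots> = real (t + 1) ^ (2 * t)
        * ((face_prob p \<tau> * a) * real n * (real n * (a * s)) ^ i')"
      using i' by (simp add: b_def power_mult_distrib ac_simps)
    also have "\<dots> \<le> real (t + 1) ^ (2 * t) * (qq p k * real n * (real n * rr p k) ^ t)"
      unfolding fa as using i' R qq_rr_nonneg[OF p n]
      by (intro mult_left_mono power_increasing) auto
    finally show "real (card {ys. ys \<in> L \<and> card (set ys) = i}) * b i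
      \<le> real (t + 1) ^ (2 * t) * (qq p k * real n * (real n * rr p k) ^ t)" .
  qed
  also have "\<dots> = real (t + 1) ^ (2 * t + 1) * (qq p k * real n * (real n * rr p k) ^ t)"
    by simp
  finally show ?thesis unfolding N_def s_def .
qed

section \<open>From local estimates to the expected Betti number\<close>

text \<open>Raise \<open>x / t \<le> exp (x / t)\<close> to the power \<open>t\<close>. The Chernoff
  bound is thereby weakened to the power decay that the walks give.\<close>

lemma exp_minus_le_power:
  assumes "x > (0 :: real)" "t \<ge> 1"
  shows "exp (- x) \<le> (real t / x) ^ t"
proof -
  have "(x / real t) ^ t \<le> exp (x / real t) ^ t"
    using assms exp_ge_add_one_self[of "x / real t"] by (intro power_mono) (linarith, simp)
  also have "\<dots> = exp x" using assms by (simp flip: exp_of_nat_mult)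
  finally have "inverse (exp x) \<le> inverse ((x / real t) ^ t)"
    using assms by (intro le_imp_inverse_le) auto
  then show ?thesis by (simp add: exp_minus power_divide)
qed

lemma card_subsets_le: "real (card {\<sigma>. \<sigma> \<subseteq> {..<n} \<and> card \<sigma> = m}) \<le> real n ^ m"
proof -
  have "n choose m \<le> n ^ m" by (cases "m \<le> n") (auto simp: binomial_le_pow binomial_eq_0)
  then have "real (n choose m) \<le> real (n ^ m)" by (rule of_nat_mono)
  then show ?thesis using n_subsets[of "{..<n}" m] by simp
qed

lemma expectation_random_complex:
  "measure_pmf.expectation (random_complex n p) (f :: _ \<Rightarrow> real)
    = measure_pmf.expectation (coins n p) (\<lambda>c. f (coin_complex n c))"
  by (simp add: random_complex_eq_coins)

lemma coin_complex_subset: "coin_complex n c \<subseteq> nonempty_faces n"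
  by (auto simp: coin_complex_def)

lemma card_coin_complex_filter:
  "real (card {\<sigma> \<in> coin_complex n c. card \<sigma> = m \<and> P \<sigma>})
    = (\<Sum>\<sigma> | \<sigma> \<subseteq> {..<n} \<and> card \<sigma> = m. of_bool (\<sigma> \<in> coin_complex n c \<and> P \<sigma>))"
proof -
  have "{\<sigma> \<in> coin_complex n c. card \<sigma> = m \<and> P \<sigma>}
      = {\<sigma>. \<sigma> \<subseteq> {..<n} \<and> card \<sigma> = m} \<inter> {\<sigma>. \<sigma> \<in> coin_complex n c \<and> P \<sigma>}"
    using coin_complex_subset by (auto simp: nonempty_faces_def)
  then show ?thesis by (simp add: sum_of_bool_eq)
qed

lemma expected_betti_le_faces:
  assumes p: "\<forall>i<n. 0 \<le> p i \<and> p i \<le> (1 :: real)" and n: "n \<ge> k + 2"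
  shows "measure_pmf.expectation (random_complex n p) (\<lambda>X. real (betti (int k) X))
    \<le> real n ^ (k + 1) * qq p k"
proof -
  let ?F = "{\<sigma>. \<sigma> \<subseteq> {..<n} \<and> card \<sigma> = k + 1}"
  have le: "real (betti (int k) (coin_complex n c)) \<le> (\<Sum>\<sigma>\<in>?F. of_bool (\<sigma> \<in> coin_complex n c))" for c
  proof -
    have "{\<sigma> \<in> coin_complex n c. finite \<sigma> \<and> card \<sigma> = k + 1}
        = {\<sigma> \<in> coin_complex n c. card \<sigma> = k + 1 \<and> True}"
      using coin_complex_subset nonempty_facesD(1) by blast
    moreover have "betti (int k) (coin_complex n c)
        \<le> card {\<sigma> \<in> coin_complex n c. finite \<sigma> \<and> card \<sigma> = k + 1}"
      by (intro betti_le_card_faces finite_coin_complex) (rule coin_complex_closed)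
    ultimately show ?thesis
      using card_coin_complex_filter[of n c "k + 1" "\<lambda>_. True"] by simp
  qed
  have "measure_pmf.expectation (random_complex n p) (\<lambda>X. real (betti (int k) X))
      \<le> measure_pmf.expectation (coins n p) (\<lambda>c. \<Sum>\<sigma>\<in>?F. of_bool (\<sigma> \<in> coin_complex n c))"
    unfolding expectation_random_complex by (intro integral_mono integrable_coins le)
  also have "\<dots> = (\<Sum>\<sigma>\<in>?F. qq p k)"
    using expectation_mem_coin_complex[OF p]
    by (subst Bochner_Integration.integral_sum) (auto intro!: sum.cong)
  also have "\<dots> \<le> real n ^ (k + 1) * qq p k"
    using card_subsets_le[of n "k + 1"] qq_rr_nonneg(1)[OF p n]
    by (simp only: sum_constant) (intro mult_right_mono, auto)
  finally show ?thesis .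
qed

lemma expected_betti_le_power:
  fixes k t n :: nat
  assumes p: "\<forall>i<n. 0 \<le> p i \<and> p i \<le> (1 :: real)" and n: "n \<ge> k + 2"
    and j: "t = 2 ^ j" and R: "real n * rr p k \<ge> 1"
  shows "measure_pmf.expectation (random_complex n p) (\<lambda>X. real (betti (int k) X))
    \<le> real n ^ (k + 1) * qq p k
      * ((2 * (real t * (2 * real (k + 2) / (1 - ln 2))) ^ t
          + (4 * real (k + 1) * real (k + 2)) ^ (2 * t) * real (t + 1) ^ (2 * t + 1))
        / (real n * rr p k) ^ t)"
proof -
  define D where "D = real (n - k - 1) * rr p k"
  define B where "B = 4 * real (k + 1) * real (k + 2)"
  let ?R = "real n * rr p k"
  let ?F = "{\<sigma>. \<sigma> \<subseteq> {..<n} \<and> card \<sigma> = k + 1}" and ?T = "{\<tau>. \<tau> \<subseteq> {..<n} \<and> card \<tau> = k}"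
  define bad where "bad c \<sigma> \<longleftrightarrow> \<sigma> \<in> coin_complex n c
    \<and> real (face_degree n (coin_complex n c) \<sigma>) < D / 2" for c \<sigma>
  define W where "W \<tau> c = (\<Sum>u\<in>{..<n} - \<tau>. \<Sum>w\<in>{..<n} - \<tau>.
      (mat_pow ({..<n} - \<tau>) (link_matrix (coin_complex n c) (link_prob p 1 \<tau>) \<tau>) t u w)\<^sup>2)" for \<tau> c
  have t: "t \<ge> 1" by (simp add: j)
  have q0: "0 \<le> qq p k" and r0: "0 \<le> rr p k" using qq_rr_nonneg[OF p n] by auto
  \<comment> \<open>The mean degree \<open>D\<close> counts only the \<open>n - k - 1\<close>
    vertices outside a face. Since \<open>n \<ge> k + 2\<close>, replacing it by
    \<open>n * rr p k\<close> costs at most a factor \<open>k + 2\<close>, with equality at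
    \<open>n = k + 2\<close>; this is the source of \<open>k + 2\<close> in the constants.\<close>
  have RD: "?R \<le> real (k + 2) * D"
  proof -
    obtain m where m: "n = m + k + 2" using n by (metis add.commute le_Suc_ex add.assoc)
    have "n \<le> (k + 2) * (n - k - 1)" by (simp add: m algebra_simps)
    then have "real n \<le> real (k + 2) * real (n - k - 1)" by (metis of_nat_le_iff of_nat_mult)
    from mult_right_mono[OF this r0] show ?thesis
      by (simp only: D_def mult.assoc)
  qed
  then have "0 < real (k + 2) * D" using R by linarith
  then have D0: "D > 0" by (simp add: zero_less_mult_iff)
  have ln2: "ln 2 < (1 :: real)" by (rule ln_2_less_1)
  have pointwise: "real (betti (int k) (coin_complex n c))
      \<le> 2 * (\<Sum>\<sigma>\<in>?F. of_bool (bad c \<sigma>)) + (4 * real (k + 1) / D) ^ (2 * t) * (\<Sum>\<tau>\<in>?T. W \<tau> c)" for c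
  proof -
    have "0 \<le> link_prob p 1 \<tau>" if "\<tau> \<subseteq> {..<n}" "card \<tau> = k" for \<tau>
      using that n by (intro link_prob_bounds[OF p]) (auto intro: finite_subset)
    moreover have "\<tau> \<in> coin_complex n c" if "\<sigma> \<in> coin_complex n c" "\<tau> \<subseteq> \<sigma>" "\<tau> \<noteq> {}" for \<sigma> \<tau>
      using that by (rule coin_complex_closed)
    ultimately have "real (betti (int k) (coin_complex n c))
      \<le> 2 * real (card {\<sigma> \<in> coin_complex n c. card \<sigma> = k + 1
          \<and> real (face_degree n (coin_complex n c) \<sigma>) < D / 2})
        + (4 * real (k + 1) / D) ^ (2 * 2 ^ j) * (\<Sum>\<tau>\<in>?T. W \<tau> c)"
      unfolding W_def j by (intro betti_le_local coin_complex_subset D0)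
    then
    show ?thesis
      by (simp only: card_coin_complex_filter bad_def j)
  qed
  have "measure_pmf.expectation (random_complex n p) (\<lambda>X. real (betti (int k) X))
      \<le> measure_pmf.expectation (coins n p) (\<lambda>c. 2 * (\<Sum>\<sigma>\<in>?F. of_bool (bad c \<sigma>))
        + (4 * real (k + 1) / D) ^ (2 * t) * (\<Sum>\<tau>\<in>?T. W \<tau> c))"
    unfolding expectation_random_complex by (intro integral_mono integrable_coins pointwise)
  also have "\<dots> = 2 * (\<Sum>\<sigma>\<in>?F. measure_pmf.expectation (coins n p) (\<lambda>c. of_bool (bad c \<sigma>)))
      + (4 * real (k + 1) / D) ^ (2 * t) * (\<Sum>\<tau>\<in>?T. measure_pmf.expectation (coins n p) (W \<tau>))"
    by (simp add: Bochner_Integration.integral_sum del: sum_of_bool_eq)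
  also have "\<dots> \<le> 2 * (\<Sum>\<sigma>\<in>?F. qq p k * exp (- ((1 - ln 2) / 2 * D)))
      + (4 * real (k + 1) / D) ^ (2 * t)
        * (\<Sum>\<tau>\<in>?T. real (t + 1) ^ (2 * t + 1) * (qq p k * real n * ?R ^ t))"
    unfolding bad_def W_def using D0
    by (intro add_mono mult_left_mono sum_mono expectation_low_degree[OF p _ _ n D_def]
        expectation_link_matrix_pow[OF p _ _ n t R]) auto
  also have "\<dots> = 2 * (real (card ?F) * (qq p k * exp (- ((1 - ln 2) / 2 * D))))
      + (4 * real (k + 1) / D) ^ (2 * t)
        * (real (card ?T) * (real (t + 1) ^ (2 * t + 1) * (qq p k * real n * ?R ^ t)))"
    by simp
  also have "\<dots> \<le> 2 * (real n ^ (k + 1) * (qq p k * ((real t * (2 * real (k + 2) / (1 - ln 2))) ^ t / ?R ^ t)))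
      + (B / ?R) ^ (2 * t)
        * (real n ^ k * (real (t + 1) ^ (2 * t + 1) * (qq p k * real n * ?R ^ t)))"
  proof (intro add_mono mult_left_mono mult_mono power_mono card_subsets_le)
    have "exp (- ((1 - ln 2) / 2 * D)) \<le> (real t / ((1 - ln 2) / 2 * D)) ^ t"
      using ln2 D0 t by (intro exp_minus_le_power) auto
    also have "\<dots> \<le> (real t * (2 * real (k + 2) / (1 - ln 2)) / ?R) ^ t"
    proof (intro power_mono)
      have "1 / D \<le> real (k + 2) / ?R" using RD D0 R by (simp add: field_simps)
      from mult_left_mono[OF this, of "real t * 2 / (1 - ln 2)"]
      show "real t / ((1 - ln 2) / 2 * D) \<le> real t * (2 * real (k + 2) / (1 - ln 2)) / ?R"
        using ln2 by (simp add: ac_simps)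
    qed (use ln2 D0 in auto)
    finally show "exp (- ((1 - ln 2) / 2 * D)) \<le> (real t * (2 * real (k + 2) / (1 - ln 2))) ^ t / ?R ^ t"
      by (simp only: power_divide)
    have "1 / D \<le> real (k + 2) / ?R" using RD D0 R by (simp add: field_simps)
    from mult_left_mono[OF this, of "4 * real (k + 1)"]
    show "4 * real (k + 1) / D \<le> B / ?R" by (simp add: B_def)
  qed (use D0 q0 R r0 in \<open>auto simp: B_def\<close>)
  also have "\<dots> = real n ^ (k + 1) * qq p k
      * ((2 * (real t * (2 * real (k + 2) / (1 - ln 2))) ^ t + B ^ (2 * t) * real (t + 1) ^ (2 * t + 1)) / ?R ^ t)"
  proof -
    have "(B / ?R) ^ (2 * t) * ?R ^ t = B ^ (2 * t) / ?R ^ t"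
      using R by (simp add: power_divide mult_2 power_add)
    moreover have "(B / ?R) ^ (2 * t) * (real n ^ k * (real (t + 1) ^ (2 * t + 1) * (qq p k * real n * ?R ^ t)))
        = ((B / ?R) ^ (2 * t) * ?R ^ t) * ((real n ^ k * real n) * qq p k * real (t + 1) ^ (2 * t + 1))"
      by (simp only: ac_simps)
    ultimately have "(B / ?R) ^ (2 * t) * (real n ^ k * (real (t + 1) ^ (2 * t + 1) * (qq p k * real n * ?R ^ t)))
        = (B ^ (2 * t) / ?R ^ t) * (real n ^ (k + 1) * qq p k * real (t + 1) ^ (2 * t + 1))"
      by simp
    then show ?thesis by (simp only: add_divide_distrib distrib_left) (simp add: ac_simps)
  qed
  finally show ?thesis unfolding B_def .
qed

theorem theorem3p6:
  fixes k l :: nat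
  assumes "l \<ge> 1"
  shows "\<exists>C::real. C \<ge> 0 \<and>
    (\<forall>(n::nat) (p :: nat \<Rightarrow> real). n \<ge> k + 2 \<longrightarrow> (\<forall>i<n. 0 \<le> p i \<and> p i \<le> 1) \<longrightarrow>
      measure_pmf.expectation (random_complex n p) (\<lambda>X. real (betti (int k) X))
        \<le> real n ^ (k + 1) * qq p k *
          (if rr p k = 0 then 1 else min 1 (C * (real n * rr p k) powi (- int l))))"
proof -
  \<comment> \<open>A power of two, as the induction that squares the operator demands, and at least
    \<open>l\<close>, so that \<open>?R ^ l \<le> ?R ^ t\<close> whenever
    \<open>?R \<ge> 1\<close>.\<close>
  define t :: nat where "t = 2 ^ l"
  define A where "A = 2 * (real t * (2 * real (k + 2) / (1 - ln 2))) ^ t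
    + (4 * real (k + 1) * real (k + 2)) ^ (2 * t) * real (t + 1) ^ (2 * t + 1)"
  \<comment> \<open>The lower bound 1 makes the minimum in the claim equal to 1 for
    \<open>0 < ?R < 1\<close>, where the count of faces suffices.\<close>
  define C where "C = max 1 A"
  have C: "C \<ge> 1" "C \<ge> A" by (simp_all add: C_def)
  have "measure_pmf.expectation (random_complex n p) (\<lambda>X. real (betti (int k) X))
      \<le> real n ^ (k + 1) * qq p k *
        (if rr p k = 0 then 1 else min 1 (C * (real n * rr p k) powi (- int l)))"
    if n: "n \<ge> k + 2" and p: "\<forall>i<n. 0 \<le> p i \<and> p i \<le> 1" for n and p :: "nat \<Rightarrow> real"
  proof -
    let ?E = "measure_pmf.expectation (random_complex n p) (\<lambda>X. real (betti (int k) X))"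
    let ?R = "real n * rr p k"
    have faces: "?E \<le> real n ^ (k + 1) * qq p k * 1"
      using expected_betti_le_faces[OF p n] by simp
    have q: "0 \<le> real n ^ (k + 1) * qq p k" using qq_rr_nonneg(1)[OF p n] by simp
    have powi: "?R powi (- int l) = 1 / ?R ^ l"
      by (simp add: power_int_minus inverse_eq_divide)
    consider "rr p k = 0" | "rr p k \<noteq> 0" "?R < 1" | "rr p k \<noteq> 0" "?R \<ge> 1" by linarith
    then show ?thesis
    proof cases
      case 1
      then show ?thesis using faces by simp
    next
      case 2
      then have "0 < ?R" using qq_rr_nonneg(2)[OF p n] n by simp
      then have "1 \<le> 1 / ?R ^ l" using 2 by (simp add: power_le_one)
      then have "1 \<le> C * (1 / ?R ^ l)" using C(1) mult_mono[of 1 C 1 "1 / ?R ^ l"] by simp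
      then show ?thesis using 2 faces unfolding powi by (simp add: min_absorb1)
    next
      case 3
      have "?E \<le> real n ^ (k + 1) * qq p k * (A / ?R ^ t)"
        using expected_betti_le_power[OF p n t_def 3(2)] by (simp add: A_def)
      also have "\<dots> \<le> real n ^ (k + 1) * qq p k * (C * (1 / ?R ^ l))"
      proof (intro mult_left_mono q)
        have "l \<le> t" unfolding t_def using less_exp[of l] by simp
        then have "?R ^ l \<le> ?R ^ t" using 3(2) by (intro power_increasing)
        then have "1 / ?R ^ t \<le> 1 / ?R ^ l" using 3(2) by (intro divide_left_mono) auto
        then have "A * (1 / ?R ^ t) \<le> C * (1 / ?R ^ l)"
          using C 3(2) by (intro mult_mono) auto
        then show "A / ?R ^ t \<le> C * (1 / ?R ^ l)" by simp
      qed
      finally show ?thesis using 3 faces unfolding powi by (simp add: min_def)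
    qed
  qed
  moreover have "C \<ge> 0" using C(1) by simp
  ultimately show ?thesis by blast
qed

end
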